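(* Let $U$ be a completely simple semigroup, let $H$ be a maximal subgroup of $U$, and let $\langle E(U)\rangle$ be the subsemigroup generated by the idempotents of $U$. Then $U$ is of type left-$\mathrm{FP}_1$ if and only if the following two conditions are satisfied: (i) $U$ has finitely many right ideals, and (ii) the subgroup $K$ of $H$ generated by $\langle E(U)\rangle\cap H$ has finite relative rank in $H$.
   Context: For a monoid $S$, $\mathbb{Z}S$ denotes the integral monoid ring, and $\mathbb{Z}$ is regarded as the trivial left $\mathbb{Z}S$-module via the augmentation $\epsilon_S:\mathbb{Z}S\to\mathbb{Z}$, $s\mapsto 1$ ($s\in S$). The monoid $S$ is of type left-$\mathrm{FP}_1$ if there is an exact sequence $A_1\to A_0\to\mathbb{Z}\to 0$ of left $\mathbb{Z}S$-modules with $A_0,A_1$ finitely generated free. A semigroup $S$ without a two-sided identity is of type left-$\mathrm{FP}_1$ if the monoid $S^1=S\cup\{1\}$, obtained by adjoining an identity element, is. A semigroup is simple if it has no proper two-sided ideals, and completely simple if it is simple and has minimal left and minimal right ideals. $E(U)$ is the set of idempotents of $U$. For an idempotent $e\in U$, the maximal subgroup of $U$ containing $e$ is the group of units of $eUe$. For a semigroup $S$ and a subsemigroup $T$, the relative rank of $T$ in $S$ is $\mathrm{rank}(S:T)=\inf_{A\subseteq S}\{|A| : \langle T\cup A\rangle=S\}$, where $\langle X\rangle$ denotes the subsemigroup generated by $X$. *)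

theory Defs
  imports
    "HOL-Algebra.Generated_Groups"
    "HOL-Algebra.Module"
    "HOL-Library.Poly_Mapping"
    "HOL-Library.Extended_Nat"
begin

section \<open>Semigroups\<close>

text \<open>
  A semigroup is a nonempty multiplicatively closed subset of a type of class
  \<^class>\<open>semigroup_mult\<close>. Ideals are nonempty.
\<close>

definition subsemigroup :: "'a::semigroup_mult set \<Rightarrow> bool" where
  "subsemigroup U \<longleftrightarrow> U \<noteq> {} \<and> (\<forall>x\<in>U. \<forall>y\<in>U. x * y \<in> U)"

inductive_set semigroup_span :: "'a::semigroup_mult set \<Rightarrow> 'a set" for X where
  incl: "x \<in> X \<Longrightarrow> x \<in> semigroup_span X"
| mult: "x \<in> semigroup_span X \<Longrightarrow> y \<in> semigroup_span X \<Longrightarrow> x * y \<in> semigroup_span X"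

definition idempotents :: "'a::semigroup_mult set \<Rightarrow> 'a set" where
  "idempotents U = {e \<in> U. e * e = e}"

definition left_ideal :: "'a::semigroup_mult set \<Rightarrow> 'a set \<Rightarrow> bool" where
  "left_ideal U I \<longleftrightarrow> I \<noteq> {} \<and> I \<subseteq> U \<and> (\<forall>u\<in>U. \<forall>x\<in>I. u * x \<in> I)"

definition right_ideal :: "'a::semigroup_mult set \<Rightarrow> 'a set \<Rightarrow> bool" where
  "right_ideal U I \<longleftrightarrow> I \<noteq> {} \<and> I \<subseteq> U \<and> (\<forall>u\<in>U. \<forall>x\<in>I. x * u \<in> I)"

definition simple_semigroup :: "'a::semigroup_mult set \<Rightarrow> bool" where
  "simple_semigroup U \<longleftrightarrow>
     subsemigroup U \<and> (\<forall>I. left_ideal U I \<and> right_ideal U I \<longrightarrow> I = U)"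

definition minimal_left_ideal :: "'a::semigroup_mult set \<Rightarrow> 'a set \<Rightarrow> bool" where
  "minimal_left_ideal U L \<longleftrightarrow>
     left_ideal U L \<and> (\<forall>I. left_ideal U I \<and> I \<subseteq> L \<longrightarrow> I = L)"

definition minimal_right_ideal :: "'a::semigroup_mult set \<Rightarrow> 'a set \<Rightarrow> bool" where
  "minimal_right_ideal U R \<longleftrightarrow>
     right_ideal U R \<and> (\<forall>I. right_ideal U I \<and> I \<subseteq> R \<longrightarrow> I = R)"

definition completely_simple :: "'a::semigroup_mult set \<Rightarrow> bool" where
  "completely_simple U \<longleftrightarrow>
     simple_semigroup U \<and> (\<exists>L. minimal_left_ideal U L) \<and> (\<exists>R. minimal_right_ideal U R)"

definition local_monoid :: "'a::semigroup_mult set \<Rightarrow> 'a \<Rightarrow> 'a monoid" where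
  "local_monoid U e = \<lparr>carrier = {e * u * e | u. u \<in> U}, monoid.mult = (*), one = e\<rparr>"

definition maximal_subgroup :: "'a::semigroup_mult set \<Rightarrow> 'a monoid \<Rightarrow> bool" where
  "maximal_subgroup U H \<longleftrightarrow> (\<exists>e\<in>idempotents U. H = units_of (local_monoid U e))"

text \<open>All infinite cardinalities are collapsed to \<open>\<infinity>\<close>.\<close>

definition ecard :: "'a set \<Rightarrow> enat" where
  "ecard A = (if finite A then enat (card A) else \<infinity>)"

definition relative_rank :: "'a::semigroup_mult set \<Rightarrow> 'a set \<Rightarrow> enat" where
  "relative_rank S T = (INF A \<in> {A. A \<subseteq> S \<and> semigroup_span (T \<union> A) = S}. ecard A)"

section \<open>Left modules over a not necessarily commutative ring\<close>

text \<open>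
  The library locale \<^locale>\<open>module\<close> requires a commutative ring of scalars. As there, the
  multiplicative fields of the module record play no role.
\<close>

locale left_module = R?: ring R + M?: abelian_group M for R (structure) and M (structure) +
  assumes smult_closed: "\<lbrakk>a \<in> carrier R; x \<in> carrier M\<rbrakk> \<Longrightarrow> a \<odot>\<^bsub>M\<^esub> x \<in> carrier M"
    and smult_l_distr: "\<lbrakk>a \<in> carrier R; b \<in> carrier R; x \<in> carrier M\<rbrakk> \<Longrightarrow>
      (a \<oplus> b) \<odot>\<^bsub>M\<^esub> x = a \<odot>\<^bsub>M\<^esub> x \<oplus>\<^bsub>M\<^esub> b \<odot>\<^bsub>M\<^esub> x"
    and smult_r_distr: "\<lbrakk>a \<in> carrier R; x \<in> carrier M; y \<in> carrier M\<rbrakk> \<Longrightarrow>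
      a \<odot>\<^bsub>M\<^esub> (x \<oplus>\<^bsub>M\<^esub> y) = a \<odot>\<^bsub>M\<^esub> x \<oplus>\<^bsub>M\<^esub> a \<odot>\<^bsub>M\<^esub> y"
    and smult_assoc: "\<lbrakk>a \<in> carrier R; b \<in> carrier R; x \<in> carrier M\<rbrakk> \<Longrightarrow>
      (a \<otimes> b) \<odot>\<^bsub>M\<^esub> x = a \<odot>\<^bsub>M\<^esub> (b \<odot>\<^bsub>M\<^esub> x)"
    and smult_one: "x \<in> carrier M \<Longrightarrow> \<one> \<odot>\<^bsub>M\<^esub> x = x"

definition left_module_hom ::
  "'r ring \<Rightarrow> ('r, 'm) module \<Rightarrow> ('r, 'n) module \<Rightarrow> ('m \<Rightarrow> 'n) set" where
  "left_module_hom R M N = {h \<in> carrier M \<rightarrow> carrier N.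
     (\<forall>x\<in>carrier M. \<forall>y\<in>carrier M. h (x \<oplus>\<^bsub>M\<^esub> y) = h x \<oplus>\<^bsub>N\<^esub> h y) \<and>
     (\<forall>a\<in>carrier R. \<forall>x\<in>carrier M. h (a \<odot>\<^bsub>M\<^esub> x) = a \<odot>\<^bsub>N\<^esub> h x)}"

text \<open>
  Finitely generated free: there is a finite basis. The coefficient families are extensional
  functions, so uniqueness concerns their values on the basis only.
\<close>

definition fg_free :: "'r ring \<Rightarrow> ('r, 'm) module \<Rightarrow> bool" where
  "fg_free R M \<longleftrightarrow> left_module R M \<and>
     (\<exists>B. finite B \<and> B \<subseteq> carrier M \<and>
        (\<forall>x\<in>carrier M. \<exists>!c. c \<in> B \<rightarrow>\<^sub>E carrier R \<and> x = (\<Oplus>\<^bsub>M\<^esub>b\<in>B. c b \<odot>\<^bsub>M\<^esub> b)))"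

section \<open>Monoid rings and the property left-$\mathrm{FP}_1$\<close>

text \<open>
  The multiplication is the bilinear extension of the multiplication of \<open>S\<close>:
  \<open>frag_of s\<close> is the basis element \<open>s\<close>, and \<open>frag_extend\<close> extends linearly.
\<close>

definition monoid_ring :: "'s monoid \<Rightarrow> ('s \<Rightarrow>\<^sub>0 int) ring" where
  "monoid_ring S =
     \<lparr>carrier = {x. Poly_Mapping.keys x \<subseteq> carrier S},
      monoid.mult = (\<lambda>x y. frag_extend (\<lambda>s. frag_extend (\<lambda>t. frag_of (s \<otimes>\<^bsub>S\<^esub> t)) y) x),
      one = frag_of \<one>\<^bsub>S\<^esub>,
      zero = 0,
      add = (+)\<rparr>"

definition augmentation :: "('s \<Rightarrow>\<^sub>0 int) \<Rightarrow> int" where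
  "augmentation x = (\<Sum>s\<in>Poly_Mapping.keys x. Poly_Mapping.lookup x s)"

definition trivial_module :: "('s \<Rightarrow>\<^sub>0 int, int) module" where
  "trivial_module =
     \<lparr>carrier = UNIV, monoid.mult = (*), one = 1, zero = 0, add = (+),
      smult = (\<lambda>x n. augmentation x * n)\<rparr>"

text \<open>
  The modules \<open>A0\<close>, \<open>A1\<close> range over carriers in the type \<^typ>\<open>nat \<Rightarrow> 's \<Rightarrow>\<^sub>0 int\<close>. This is no
  restriction: the free module of any finite rank \<open>n\<close> is realised there, by the families
  vanishing at all indices from \<open>n\<close> on.
\<close>

definition monoid_left_FP1 :: "'s monoid \<Rightarrow> bool" where
  "monoid_left_FP1 S \<longleftrightarrow>
     (\<exists>(A0 :: ('s \<Rightarrow>\<^sub>0 int, nat \<Rightarrow> 's \<Rightarrow>\<^sub>0 int) module)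
       (A1 :: ('s \<Rightarrow>\<^sub>0 int, nat \<Rightarrow> 's \<Rightarrow>\<^sub>0 int) module) d1 d0.
        fg_free (monoid_ring S) A0 \<and> fg_free (monoid_ring S) A1 \<and>
        d1 \<in> left_module_hom (monoid_ring S) A1 A0 \<and>
        d0 \<in> left_module_hom (monoid_ring S) A0 trivial_module \<and>
        d1 ` carrier A1 = {x \<in> carrier A0. d0 x = 0} \<and>
        d0 ` carrier A0 = UNIV)"

definition adjoin_one :: "'a::semigroup_mult set \<Rightarrow> 'a option monoid" where
  "adjoin_one U =
     \<lparr>carrier = insert None (Some ` U),
      monoid.mult = (\<lambda>x y. case x of None \<Rightarrow> y
        | Some a \<Rightarrow> (case y of None \<Rightarrow> x | Some b \<Rightarrow> Some (a * b))),
      one = None\<rparr>"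

definition is_identity :: "'a::semigroup_mult set \<Rightarrow> 'a \<Rightarrow> bool" where
  "is_identity U e \<longleftrightarrow> e \<in> U \<and> (\<forall>x\<in>U. e * x = x \<and> x * e = x)"

definition left_FP1 :: "'a::semigroup_mult set \<Rightarrow> bool" where
  "left_FP1 U \<longleftrightarrow>
     (if \<exists>e. is_identity U e
      then monoid_left_FP1 \<lparr>carrier = U, monoid.mult = (*), one = (THE e. is_identity U e)\<rparr>
      else monoid_left_FP1 (adjoin_one U))"

end

theory Submission
  imports Defs
begin

text \<open>
  The property left-$\mathrm{FP}_1$ of a monoid \<open>S\<close> is a connectedness property. Up to a comparison
  of free presentations it says that the augmentation ideal of $\mathbb{Z}S$ is finitely generated
  as a left ideal. Expanding finitely many generators in the elements \<open>a - 1\<close>, for \<open>a\<close> in a finite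
  set \<open>A\<close>, one may take these elements as generators. The left ideal that they generate
  is the additive group spanned by the differences \<open>s a - s\<close>, so it contains every \<open>t - 1\<close> exactly
  when the right Cayley graph of \<open>S\<close> with respect to \<open>A\<close>, with edges joining \<open>s\<close> and \<open>s a\<close> read without
  orientation, is connected. This is the content of \<open>left_FP1_iff_cayley_connected\<close>; for the
  monoid attached to a semigroup \<open>U\<close> it becomes a condition on \<open>U\<close> itself in
  \<open>left_FP1_iff_right_connected\<close>.

  A completely simple semigroup \<open>U\<close> with a chosen idempotent \<open>e\<close> has Rees coordinates: every \<open>u\<close>
  is a product \<open>q h l\<close>, where \<open>h = e u e\<close> lies in the maximal subgroup \<open>G = e U e\<close>, the idempotent \<open>q\<close>
  represents the minimal right ideal of \<open>u\<close>, and the idempotent \<open>l\<close> its minimal left ideal. Taking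
  \<open>q\<close> in \<open>U e\<close> and \<open>l\<close> in \<open>e U\<close> normalises the sandwich matrix, whose entries are the products \<open>l q\<close>,
  at \<open>e\<close>. Its entries then generate the same subgroup \<open>K\<close> of \<open>G\<close>
  as the products of idempotents that lie in \<open>G\<close> (\<open>generate_idempotent_core\<close>).

  Right multiplication never changes \<open>q\<close>, so a connected Cayley graph needs a vertex of \<open>A\<close> in
  every minimal right ideal; this forces finitely many right ideals. Multiplying by \<open>a\<close> on the
  right multiplies the \<open>G\<close>-coordinate on the right by a sandwich entry and by \<open>e a e\<close>. Hence the elements
  whose coordinate lies in the subgroup generated by \<open>K\<close> and all \<open>e a e\<close> are not joined to any others, and
  connectedness makes this subgroup all of \<open>G\<close>. Conversely, let the set \<open>Q\<close> of all \<open>q\<close> be finite and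
  let \<open>G\<close> be generated by \<open>K\<close> and a finite set \<open>B\<close>. Then the finite set of all \<open>q b\<close> with \<open>q \<in> Q\<close> and
  \<open>b \<in> B \<union> {e}\<close> connects everything: the edges \<open>q\<close> realise multiplication of the
  \<open>G\<close>-coordinate by all sandwich entries, even when \<open>U\<close> has infinitely many left ideals.
\<close>

section \<open>Left modules\<close>

lemma finsum_induct:
  assumes "abelian_monoid M" "finite B" "\<And>b. b \<in> B \<Longrightarrow> f b \<in> carrier M \<and> P (f b)"
    and "P \<zero>\<^bsub>M\<^esub>" "\<And>x y. x \<in> carrier M \<Longrightarrow> y \<in> carrier M \<Longrightarrow> P x \<Longrightarrow> P y \<Longrightarrow> P (x \<oplus>\<^bsub>M\<^esub> y)"
  shows "P (\<Oplus>\<^bsub>M\<^esub>b\<in>B. f b)"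
proof -
  interpret abelian_monoid M by fact
  show ?thesis
    using assms(2,3)
  proof (induction B rule: finite_induct)
    case (insert b B)
    moreover have "(\<Oplus>\<^bsub>M\<^esub>b\<in>B. f b) \<in> carrier M"
      using insert by (intro finsum_closed) auto
    ultimately show ?case
      using assms(5) by (simp add: Pi_def finsum_insert)
  qed (simp add: assms(4))
qed

context left_module
begin

lemma smult_r_null:
  assumes "a \<in> carrier R"
  shows "a \<odot>\<^bsub>M\<^esub> \<zero>\<^bsub>M\<^esub> = \<zero>\<^bsub>M\<^esub>"
proof -
  have "a \<odot>\<^bsub>M\<^esub> \<zero>\<^bsub>M\<^esub> \<oplus>\<^bsub>M\<^esub> a \<odot>\<^bsub>M\<^esub> \<zero>\<^bsub>M\<^esub> = a \<odot>\<^bsub>M\<^esub> \<zero>\<^bsub>M\<^esub> \<oplus>\<^bsub>M\<^esub> \<zero>\<^bsub>M\<^esub>"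
    using smult_r_distr[OF assms, of "\<zero>\<^bsub>M\<^esub>" "\<zero>\<^bsub>M\<^esub>"] smult_closed[OF assms, of "\<zero>\<^bsub>M\<^esub>"] by simp
  then show ?thesis
    using smult_closed[OF assms, of "\<zero>\<^bsub>M\<^esub>"] by (simp del: M.r_zero)
qed

lemma smult_l_null:
  assumes "x \<in> carrier M"
  shows "\<zero> \<odot>\<^bsub>M\<^esub> x = \<zero>\<^bsub>M\<^esub>"
proof -
  have "\<zero> \<odot>\<^bsub>M\<^esub> x \<oplus>\<^bsub>M\<^esub> \<zero> \<odot>\<^bsub>M\<^esub> x = \<zero> \<odot>\<^bsub>M\<^esub> x \<oplus>\<^bsub>M\<^esub> \<zero>\<^bsub>M\<^esub>"
    using smult_l_distr[of \<zero> \<zero> x] smult_closed[of \<zero> x] assms by simp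
  then show ?thesis
    using smult_closed[of \<zero> x] assms by (simp del: M.r_zero)
qed

lemma finsum_smult:
  assumes "a \<in> carrier R" "finite B" "f \<in> B \<rightarrow> carrier M"
  shows "a \<odot>\<^bsub>M\<^esub> (\<Oplus>\<^bsub>M\<^esub>b\<in>B. f b) = (\<Oplus>\<^bsub>M\<^esub>b\<in>B. a \<odot>\<^bsub>M\<^esub> f b)"
  using assms(2,3)
  by (induction B rule: finite_induct)
     (simp_all add: assms(1) smult_r_null smult_r_distr smult_closed Pi_def finsum_insert)

end

lemma left_module_hom_finsum:
  assumes "left_module R M" "left_module R N" and h: "h \<in> left_module_hom R M N"
    and "finite B" "c \<in> B \<rightarrow> carrier R" "v \<in> B \<rightarrow> carrier M"
  shows "h (\<Oplus>\<^bsub>M\<^esub>b\<in>B. c b \<odot>\<^bsub>M\<^esub> v b) = (\<Oplus>\<^bsub>N\<^esub>b\<in>B. c b \<odot>\<^bsub>N\<^esub> h (v b))"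
proof -
  interpret M: left_module R M by fact
  interpret N: left_module R N by fact
  have h': "\<And>x. x \<in> carrier M \<Longrightarrow> h x \<in> carrier N"
    "\<And>x y. x \<in> carrier M \<Longrightarrow> y \<in> carrier M \<Longrightarrow> h (x \<oplus>\<^bsub>M\<^esub> y) = h x \<oplus>\<^bsub>N\<^esub> h y"
    "\<And>a x. a \<in> carrier R \<Longrightarrow> x \<in> carrier M \<Longrightarrow> h (a \<odot>\<^bsub>M\<^esub> x) = a \<odot>\<^bsub>N\<^esub> h x"
    using h by (auto simp: left_module_hom_def)
  have "h \<zero>\<^bsub>M\<^esub> = \<zero>\<^bsub>R\<^esub> \<odot>\<^bsub>N\<^esub> h \<zero>\<^bsub>M\<^esub>"
    using h'(3)[of "\<zero>\<^bsub>R\<^esub>" "\<zero>\<^bsub>M\<^esub>"] by (simp add: M.smult_l_null)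
  then have "h \<zero>\<^bsub>M\<^esub> = \<zero>\<^bsub>N\<^esub>"
    by (simp add: N.smult_l_null h')
  with assms(4-) show ?thesis
  proof (induction B rule: finite_induct)
    case (insert b B)
    have "(\<Oplus>\<^bsub>M\<^esub>b\<in>B. c b \<odot>\<^bsub>M\<^esub> v b) \<in> carrier M"
      using insert by (intro M.finsum_closed) (auto intro: M.smult_closed)
    with insert show ?case
      by (simp add: Pi_def M.finsum_insert N.finsum_insert M.smult_closed N.smult_closed h')
  qed simp
qed

text \<open>
  The universal property of a free module, with the value of the extension given on all linear
  combinations of the basis.
\<close>

lemma fg_free_extend:
  assumes M: "left_module R M" and N: "left_module R N"
    and B: "finite B" "B \<subseteq> carrier M"
    and basis: "\<forall>x\<in>carrier M. \<exists>!c. c \<in> B \<rightarrow>\<^sub>E carrier R \<and> x = (\<Oplus>\<^bsub>M\<^esub>b\<in>B. c b \<odot>\<^bsub>M\<^esub> b)"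
    and v: "v \<in> B \<rightarrow> carrier N"
  obtains \<psi> where "\<psi> \<in> left_module_hom R M N"
    and "\<And>c. c \<in> B \<rightarrow>\<^sub>E carrier R \<Longrightarrow>
      \<psi> (\<Oplus>\<^bsub>M\<^esub>b\<in>B. c b \<odot>\<^bsub>M\<^esub> b) = (\<Oplus>\<^bsub>N\<^esub>b\<in>B. c b \<odot>\<^bsub>N\<^esub> v b)"
proof -
  interpret M: left_module R M by fact
  interpret N: left_module R N by fact
  define lin where "lin c = (\<Oplus>\<^bsub>M\<^esub>b\<in>B. c b \<odot>\<^bsub>M\<^esub> b)" for c
  define coord where "coord x = (THE c. c \<in> B \<rightarrow>\<^sub>E carrier R \<and> x = lin c)" for x
  define \<psi> where "\<psi> x = (\<Oplus>\<^bsub>N\<^esub>b\<in>B. coord x b \<odot>\<^bsub>N\<^esub> v b)" for x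
  have coord: "coord x \<in> B \<rightarrow>\<^sub>E carrier R \<and> x = lin (coord x)" if "x \<in> carrier M" for x
    using theI'[OF basis[rule_format, OF that]] unfolding coord_def lin_def by simp
  have lin_closed: "lin c \<in> carrier M" if "c \<in> B \<rightarrow>\<^sub>E carrier R" for c
    using that B by (auto simp: lin_def intro!: M.finsum_closed M.smult_closed)
  have coord_lin: "coord (lin c) = c" if "c \<in> B \<rightarrow>\<^sub>E carrier R" for c
    using the1_equality[OF basis[rule_format, OF lin_closed[OF that]], of c] that
    unfolding coord_def lin_def by simp
  have vN: "v b \<in> carrier N" if "b \<in> B" for b using v that by auto
  have bM: "b \<in> carrier M" if "b \<in> B" for b using B that by auto
  have cR: "coord x b \<in> carrier R" if "b \<in> B" "x \<in> carrier M" for x b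
    using coord[OF that(2)] that(1) by auto
  have coord_add: "coord (x \<oplus>\<^bsub>M\<^esub> y) = (\<lambda>b\<in>B. coord x b \<oplus>\<^bsub>R\<^esub> coord y b)" (is "_ = ?c")
    if x: "x \<in> carrier M" and y: "y \<in> carrier M" for x y
  proof -
    have "lin ?c = (\<Oplus>\<^bsub>M\<^esub>b\<in>B. coord x b \<odot>\<^bsub>M\<^esub> b \<oplus>\<^bsub>M\<^esub> coord y b \<odot>\<^bsub>M\<^esub> b)"
      unfolding lin_def using x y
      by (intro M.finsum_cong') (auto simp: M.smult_l_distr cR bM intro!: M.smult_closed M.a_closed)
    also have "\<dots> = lin (coord x) \<oplus>\<^bsub>M\<^esub> lin (coord y)"
      unfolding lin_def using x y by (intro M.finsum_addf) (auto intro: M.smult_closed cR bM)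
    also have "\<dots> = x \<oplus>\<^bsub>M\<^esub> y"
      using coord x y by simp
    finally show ?thesis
      using coord_lin[of ?c] x y cR by (simp add: PiE_def Pi_def)
  qed
  have coord_smult: "coord (a \<odot>\<^bsub>M\<^esub> x) = (\<lambda>b\<in>B. a \<otimes>\<^bsub>R\<^esub> coord x b)" (is "_ = ?c")
    if a: "a \<in> carrier R" and x: "x \<in> carrier M" for a x
  proof -
    have "lin ?c = (\<Oplus>\<^bsub>M\<^esub>b\<in>B. a \<odot>\<^bsub>M\<^esub> (coord x b \<odot>\<^bsub>M\<^esub> b))"
      unfolding lin_def using x a
      by (intro M.finsum_cong') (auto simp: M.smult_assoc cR bM intro!: M.smult_closed M.a_closed)
    also have "\<dots> = a \<odot>\<^bsub>M\<^esub> lin (coord x)"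
      unfolding lin_def using x a B by (intro M.finsum_smult[symmetric]) (auto intro: M.smult_closed cR bM)
    also have "\<dots> = a \<odot>\<^bsub>M\<^esub> x"
      using coord x by simp
    finally show ?thesis
      using coord_lin[of ?c] a x cR by (simp add: PiE_def Pi_def)
  qed
  have "\<psi> \<in> left_module_hom R M N"
    unfolding left_module_hom_def
  proof (intro CollectI conjI ballI)
    show "\<psi> \<in> carrier M \<rightarrow> carrier N"
      unfolding \<psi>_def by (auto intro!: N.finsum_closed N.smult_closed cR vN)
  next
    fix x y assume x: "x \<in> carrier M" and y: "y \<in> carrier M"
    have "\<psi> (x \<oplus>\<^bsub>M\<^esub> y) = (\<Oplus>\<^bsub>N\<^esub>b\<in>B. coord x b \<odot>\<^bsub>N\<^esub> v b \<oplus>\<^bsub>N\<^esub> coord y b \<odot>\<^bsub>N\<^esub> v b)"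
      unfolding \<psi>_def coord_add[OF x y] using x y
      by (intro N.finsum_cong') (auto simp: N.smult_l_distr cR vN intro!: N.smult_closed N.a_closed)
    also have "\<dots> = \<psi> x \<oplus>\<^bsub>N\<^esub> \<psi> y"
      unfolding \<psi>_def using x y by (intro N.finsum_addf) (auto intro: N.smult_closed cR vN)
    finally show "\<psi> (x \<oplus>\<^bsub>M\<^esub> y) = \<psi> x \<oplus>\<^bsub>N\<^esub> \<psi> y" .
  next
    fix a x assume a: "a \<in> carrier R" and x: "x \<in> carrier M"
    have "\<psi> (a \<odot>\<^bsub>M\<^esub> x) = (\<Oplus>\<^bsub>N\<^esub>b\<in>B. a \<odot>\<^bsub>N\<^esub> (coord x b \<odot>\<^bsub>N\<^esub> v b))"
      unfolding \<psi>_def coord_smult[OF a x] using x a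
      by (intro N.finsum_cong') (auto simp: N.smult_assoc cR vN intro!: N.smult_closed N.a_closed)
    also have "\<dots> = a \<odot>\<^bsub>N\<^esub> \<psi> x"
      unfolding \<psi>_def using x a B by (intro N.finsum_smult[symmetric]) (auto intro: N.smult_closed cR vN)
    finally show "\<psi> (a \<odot>\<^bsub>M\<^esub> x) = a \<odot>\<^bsub>N\<^esub> \<psi> x" .
  qed
  moreover have "\<psi> (lin c) = (\<Oplus>\<^bsub>N\<^esub>b\<in>B. c b \<odot>\<^bsub>N\<^esub> v b)" if "c \<in> B \<rightarrow>\<^sub>E carrier R" for c
    by (simp add: \<psi>_def coord_lin[OF that])
  ultimately show thesis
    using that by (simp add: lin_def)
qed

definition regular_module :: "'r ring \<Rightarrow> ('r, 'r) module" where
  "regular_module R =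
     \<lparr>carrier = carrier R, monoid.mult = monoid.mult R, one = \<one>\<^bsub>R\<^esub>, zero = \<zero>\<^bsub>R\<^esub>,
      add = add R, smult = monoid.mult R\<rparr>"

lemma left_module_regular_module:
  assumes "ring R"
  shows "left_module R (regular_module R)"
proof -
  interpret ring R by fact
  have "abelian_group (regular_module R)"
    by (rule abelian_groupI) (auto simp: regular_module_def a_ac intro: l_neg)
  then show ?thesis
    by (intro left_module.intro left_module_axioms.intro assms)
       (auto simp: regular_module_def m_assoc l_distr r_distr)
qed

text \<open>
  Sequences vanishing from index \<open>n\<close> on, rather than functions on a set of \<open>n\<close> indices, give free modules of all
  ranks the same type of elements.
\<close>

definition free_module :: "'r ring \<Rightarrow> nat \<Rightarrow> ('r, nat \<Rightarrow> 'r) module" where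
  "free_module R n =
     \<lparr>carrier = {x. (\<forall>i. x i \<in> carrier R) \<and> (\<forall>i\<ge>n. x i = \<zero>\<^bsub>R\<^esub>)},
      monoid.mult = (\<lambda>x y. x), one = (\<lambda>_. \<zero>\<^bsub>R\<^esub>), zero = (\<lambda>_. \<zero>\<^bsub>R\<^esub>),
      add = (\<lambda>x y i. x i \<oplus>\<^bsub>R\<^esub> y i), smult = (\<lambda>a x i. a \<otimes>\<^bsub>R\<^esub> x i)\<rparr>"

lemma left_module_free_module:
  assumes "ring R"
  shows "left_module R (free_module R n)"
proof -
  interpret ring R by fact
  have "abelian_group (free_module R n)"
  proof (rule abelian_groupI)
    fix x assume x: "x \<in> carrier (free_module R n)"
    show "\<exists>y\<in>carrier (free_module R n). y \<oplus>\<^bsub>free_module R n\<^esub> x = \<zero>\<^bsub>free_module R n\<^esub>"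
      by (rule bexI[of _ "\<lambda>i. \<ominus>\<^bsub>R\<^esub> x i"]) (use x in \<open>auto simp: free_module_def l_neg\<close>)
  qed (auto simp: free_module_def a_ac)
  then show ?thesis
    by (intro left_module.intro left_module_axioms.intro assms)
       (auto simp: free_module_def m_assoc l_distr r_distr)
qed

lemma fg_free_free_module:
  assumes "ring R" and nontrivial: "\<one>\<^bsub>R\<^esub> \<noteq> \<zero>\<^bsub>R\<^esub>"
  shows "fg_free R (free_module R n)"
proof -
  interpret ring R by fact
  let ?F = "free_module R n"
  interpret F: left_module R ?F
    by (rule left_module_free_module) fact
  define \<delta> where "\<delta> i = (\<lambda>j. if j = i then \<one>\<^bsub>R\<^esub> else \<zero>\<^bsub>R\<^esub>)" for i :: nat
  let ?B = "\<delta> ` {..<n}"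
  have inj: "inj_on \<delta> {..<n}"
    using nontrivial by (auto simp: inj_on_def \<delta>_def fun_eq_iff)
  have \<delta>F: "\<delta> i \<in> carrier ?F" if "i < n" for i
    using that by (auto simp: free_module_def \<delta>_def)
  have partial: "(\<Oplus>\<^bsub>?F\<^esub>i\<in>{..<m}. c i \<odot>\<^bsub>?F\<^esub> \<delta> i) = (\<lambda>j. if j < m then c j else \<zero>\<^bsub>R\<^esub>)"
    if "m \<le> n" "\<And>i. i < n \<Longrightarrow> c i \<in> carrier R" for c m
    using that(1)
  proof (induction m)
    case 0
    then show ?case by simp (simp add: free_module_def)
  next
    case (Suc m)
    have "(\<Oplus>\<^bsub>?F\<^esub>i\<in>{..<Suc m}. c i \<odot>\<^bsub>?F\<^esub> \<delta> i) =
        c m \<odot>\<^bsub>?F\<^esub> \<delta> m \<oplus>\<^bsub>?F\<^esub> (\<Oplus>\<^bsub>?F\<^esub>i\<in>{..<m}. c i \<odot>\<^bsub>?F\<^esub> \<delta> i)"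
      unfolding lessThan_Suc using Suc.prems that(2)
      by (intro F.finsum_insert) (auto intro!: F.smult_closed \<delta>F)
    also have "\<dots> = (\<lambda>j. if j < Suc m then c j else \<zero>\<^bsub>R\<^esub>)"
      unfolding Suc.IH[OF Suc_leD[OF Suc.prems]] using Suc.prems that(2)
      by (auto simp: free_module_def \<delta>_def fun_eq_iff less_Suc_eq)
    finally show ?case .
  qed
  have lin: "(\<Oplus>\<^bsub>?F\<^esub>b\<in>?B. c b \<odot>\<^bsub>?F\<^esub> b) = (\<lambda>j. if j < n then c (\<delta> j) else \<zero>\<^bsub>R\<^esub>)"
    if "c \<in> ?B \<rightarrow>\<^sub>E carrier R" for c
  proof -
    have "(\<Oplus>\<^bsub>?F\<^esub>b\<in>?B. c b \<odot>\<^bsub>?F\<^esub> b) = (\<Oplus>\<^bsub>?F\<^esub>i\<in>{..<n}. c (\<delta> i) \<odot>\<^bsub>?F\<^esub> \<delta> i)"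
      using that inj by (intro F.finsum_reindex) (auto intro!: F.smult_closed \<delta>F)
    also have "\<dots> = (\<lambda>j. if j < n then c (\<delta> j) else \<zero>\<^bsub>R\<^esub>)"
      using that by (intro partial) auto
    finally show ?thesis .
  qed
  have "\<exists>!c. c \<in> ?B \<rightarrow>\<^sub>E carrier R \<and> x = (\<Oplus>\<^bsub>?F\<^esub>b\<in>?B. c b \<odot>\<^bsub>?F\<^esub> b)"
    if x: "x \<in> carrier ?F" for x
  proof (rule ex1I)
    let ?c = "\<lambda>b\<in>?B. x (the_inv_into {..<n} \<delta> b)"
    have c: "?c \<in> ?B \<rightarrow>\<^sub>E carrier R"
      using x by (auto simp: free_module_def)
    have "?c (\<delta> j) = x j" if "j < n" for j
      using that by (simp add: the_inv_into_f_f[OF inj])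
    then have x_eq: "x = (\<lambda>j. if j < n then ?c (\<delta> j) else \<zero>\<^bsub>R\<^esub>)"
      using x by (auto simp: free_module_def fun_eq_iff)
    show "?c \<in> ?B \<rightarrow>\<^sub>E carrier R \<and> x = (\<Oplus>\<^bsub>?F\<^esub>b\<in>?B. ?c b \<odot>\<^bsub>?F\<^esub> b)"
      by (rule conjI[OF c trans[OF x_eq lin[OF c, symmetric]]])
    fix c' assume c': "c' \<in> ?B \<rightarrow>\<^sub>E carrier R \<and> x = (\<Oplus>\<^bsub>?F\<^esub>b\<in>?B. c' b \<odot>\<^bsub>?F\<^esub> b)"
    then have "x = (\<lambda>j. if j < n then c' (\<delta> j) else \<zero>\<^bsub>R\<^esub>)"
      using trans[OF conjunct2[OF c'] lin[OF conjunct1[OF c']]] by blast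
    then have xj: "x j = c' (\<delta> j)" if "j < n" for j
      using that by simp
    show "c' = ?c"
    proof (rule PiE_ext)
      show "c' \<in> ?B \<rightarrow>\<^sub>E carrier R" "?c \<in> ?B \<rightarrow>\<^sub>E carrier R" using c c' by auto
      show "c' b = ?c b" if "b \<in> ?B" for b
      proof -
        obtain j where "b = \<delta> j" "j < n" using \<open>b \<in> ?B\<close> by blast
        then show ?thesis using xj[of j] by (simp add: the_inv_into_f_f[OF inj])
      qed
    qed
  qed
  then show ?thesis
    unfolding fg_free_def using \<delta>F F.left_module_axioms
    by (intro conjI exI[of _ ?B]) auto
qed

section \<open>Monoid rings\<close>

text \<open>
  The constant function \<open>1\<close> gives the augmentation. The indicator function of a union of components of a
  Cayley graph gives a functional vanishing on all \<open>s a - s\<close> with \<open>a\<close> in the connection set.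
\<close>

definition weight :: "('s \<Rightarrow> int) \<Rightarrow> ('s \<Rightarrow>\<^sub>0 int) \<Rightarrow> int" where
  "weight f x = (\<Sum>s\<in>Poly_Mapping.keys x. Poly_Mapping.lookup x s * f s)"

lemma weight_superset:
  assumes "finite T" "Poly_Mapping.keys x \<subseteq> T"
  shows "weight f x = (\<Sum>s\<in>T. Poly_Mapping.lookup x s * f s)"
  unfolding weight_def using assms
  by (intro sum.mono_neutral_left) (auto simp: in_keys_iff)

lemma weight_zero [simp]: "weight f 0 = 0"
  by (simp add: weight_def)

lemma weight_frag_of [simp]: "weight f (frag_of s) = f s"
  by (simp add: weight_def)

lemma weight_add: "weight f (x + y) = weight f x + weight f y"
proof -
  let ?T = "Poly_Mapping.keys x \<union> Poly_Mapping.keys y"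
  have "Poly_Mapping.keys (x + y) \<subseteq> ?T"
    by (rule Poly_Mapping.keys_add)
  then show ?thesis
    by (simp add: weight_superset[of ?T] lookup_add algebra_simps sum.distrib)
qed

lemma weight_diff: "weight f (x - y) = weight f x - weight f y"
  using weight_add[of f "x - y" y] by simp

lemma weight_cmul: "weight f (frag_cmul n x) = n * weight f x"
  using weight_superset[of "Poly_Mapping.keys x" "frag_cmul n x" f]
  by (simp add: weight_def sum_distrib_left mult.assoc keys_cmul)

lemma augmentation_weight: "augmentation = weight (\<lambda>_. 1)"
  by (simp add: augmentation_def weight_def fun_eq_iff)

lemma frag_extend_add_fun: "frag_extend (\<lambda>s. f s + g s) x = frag_extend f x + frag_extend g x"
  by (simp add: frag_extend_def frag_cmul_distrib2 sum.distrib)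

lemma frag_extend_diff_fun: "frag_extend (\<lambda>s. f s - g s) x = frag_extend f x - frag_extend g x"
  using frag_extend_add_fun[of "\<lambda>s. f s - g s" g x] by (simp add: algebra_simps)

context
  fixes S :: "'s monoid"
  assumes S: "monoid S"
begin

interpretation S: monoid S by (rule S)

abbreviation (input) "ZS \<equiv> monoid_ring S"

lemma monoid_ring_simps:
  "x \<in> carrier ZS \<longleftrightarrow> Poly_Mapping.keys x \<subseteq> carrier S"
  "x \<oplus>\<^bsub>ZS\<^esub> y = x + y"
  "\<zero>\<^bsub>ZS\<^esub> = 0"
  "\<one>\<^bsub>ZS\<^esub> = frag_of \<one>\<^bsub>S\<^esub>"
  by (simp_all add: monoid_ring_def)

lemma monoid_ring_mult:
  "x \<otimes>\<^bsub>ZS\<^esub> y = frag_extend (\<lambda>s. frag_extend (\<lambda>t. frag_of (s \<otimes>\<^bsub>S\<^esub> t)) y) x"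
  by (simp add: monoid_ring_def)

lemma monoid_ring_mult_of [simp]: "frag_of s \<otimes>\<^bsub>ZS\<^esub> frag_of t = frag_of (s \<otimes>\<^bsub>S\<^esub> t)"
  by (simp add: monoid_ring_mult)

lemma monoid_ring_mult_linear:
  "(x + y) \<otimes>\<^bsub>ZS\<^esub> z = x \<otimes>\<^bsub>ZS\<^esub> z + y \<otimes>\<^bsub>ZS\<^esub> z"
  "(x - y) \<otimes>\<^bsub>ZS\<^esub> z = x \<otimes>\<^bsub>ZS\<^esub> z - y \<otimes>\<^bsub>ZS\<^esub> z"
  "z \<otimes>\<^bsub>ZS\<^esub> (x + y) = z \<otimes>\<^bsub>ZS\<^esub> x + z \<otimes>\<^bsub>ZS\<^esub> y"
  "z \<otimes>\<^bsub>ZS\<^esub> (x - y) = z \<otimes>\<^bsub>ZS\<^esub> x - z \<otimes>\<^bsub>ZS\<^esub> y"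
  "0 \<otimes>\<^bsub>ZS\<^esub> z = 0"
  "z \<otimes>\<^bsub>ZS\<^esub> 0 = 0"
  by (simp_all add: monoid_ring_mult frag_extend_add frag_extend_diff frag_extend_add_fun
      frag_extend_diff_fun frag_extend_eq_0)

lemma monoid_ring_mult_closed:
  assumes "x \<in> carrier ZS" "y \<in> carrier ZS"
  shows "x \<otimes>\<^bsub>ZS\<^esub> y \<in> carrier ZS"
proof -
  have "Poly_Mapping.keys (frag_extend (\<lambda>t. frag_of (s \<otimes>\<^bsub>S\<^esub> t)) y) \<subseteq> carrier S"
    if "s \<in> carrier S" for s
    using that assms(2) by (intro order_trans[OF keys_frag_extend]) (auto simp: monoid_ring_simps)
  then show ?thesis
    using assms(1) unfolding monoid_ring_simps monoid_ring_mult
    by (intro order_trans[OF keys_frag_extend]) blast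
qed

lemma monoid_ring_mult_assoc:
  assumes "x \<in> carrier ZS" "y \<in> carrier ZS" "z \<in> carrier ZS"
  shows "x \<otimes>\<^bsub>ZS\<^esub> y \<otimes>\<^bsub>ZS\<^esub> z = x \<otimes>\<^bsub>ZS\<^esub> (y \<otimes>\<^bsub>ZS\<^esub> z)"
  using assms(1)[unfolded monoid_ring_simps]
proof (induction x rule: frag_induction)
  case (one s)
  show ?case
    using assms(2)[unfolded monoid_ring_simps]
  proof (induction y rule: frag_induction)
    case (one t)
    show ?case
      using assms(3)[unfolded monoid_ring_simps]
    proof (induction z rule: frag_induction)
      case (one u)
      with \<open>s \<in> carrier S\<close> \<open>t \<in> carrier S\<close> show ?case
        by (simp add: S.m_assoc)
    qed (simp_all only: monoid_ring_mult_linear)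
  qed (simp_all only: monoid_ring_mult_linear)
qed (simp_all only: monoid_ring_mult_linear)

lemma monoid_ring_unit:
  assumes "x \<in> carrier ZS"
  shows "\<one>\<^bsub>ZS\<^esub> \<otimes>\<^bsub>ZS\<^esub> x = x" "x \<otimes>\<^bsub>ZS\<^esub> \<one>\<^bsub>ZS\<^esub> = x"
  using assms unfolding monoid_ring_simps
  by (induction x rule: frag_induction) (auto simp: monoid_ring_mult_linear)

lemma monoid_ring_diff_closed:
  "x \<in> carrier ZS \<Longrightarrow> y \<in> carrier ZS \<Longrightarrow> x - y \<in> carrier ZS"
  using keys_diff[of x y] by (auto simp: monoid_ring_simps)

lemma ring_monoid_ring: "ring ZS"
proof (rule ringI)
  show "abelian_group ZS"
  proof (rule abelian_groupI)
    fix x y assume "x \<in> carrier ZS" "y \<in> carrier ZS"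
    then show "x \<oplus>\<^bsub>ZS\<^esub> y \<in> carrier ZS"
      using Poly_Mapping.keys_add[of x y] by (auto simp: monoid_ring_simps)
  next
    fix x assume "x \<in> carrier ZS"
    then show "\<exists>y\<in>carrier ZS. y \<oplus>\<^bsub>ZS\<^esub> x = \<zero>\<^bsub>ZS\<^esub>"
      by (intro bexI[of _ "- x"]) (auto simp: monoid_ring_simps)
  qed (auto simp: monoid_ring_simps algebra_simps)
  show "monoid ZS"
    by (rule monoidI)
      (auto simp: monoid_ring_mult_closed monoid_ring_mult_assoc monoid_ring_unit,
        simp add: monoid_ring_simps)
qed (simp_all add: monoid_ring_simps monoid_ring_mult_linear)

text \<open>
  A function that is invariant under right multiplication by the support of \<open>y\<close> cannot distinguish
  \<open>s \<otimes> y\<close> from \<open>s\<close> taken \<open>augmentation y\<close> times.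
\<close>

lemma weight_mult:
  assumes "x \<in> carrier ZS" "Poly_Mapping.keys y \<subseteq> A"
    and invariant: "\<And>s a. s \<in> carrier S \<Longrightarrow> a \<in> A \<Longrightarrow> f (s \<otimes>\<^bsub>S\<^esub> a) = f s"
  shows "weight f (x \<otimes>\<^bsub>ZS\<^esub> y) = weight f x * augmentation y"
  using assms(1)[unfolded monoid_ring_simps]
proof (induction x rule: frag_induction)
  case (one s)
  show ?case
    using assms(2)
    by (induction y rule: frag_induction)
       (simp_all add: monoid_ring_mult_linear augmentation_weight weight_diff invariant one algebra_simps)
qed (simp_all add: monoid_ring_mult_linear weight_diff algebra_simps)

lemma augmentation_mult:
  assumes "x \<in> carrier ZS" "y \<in> carrier ZS"
  shows "augmentation (x \<otimes>\<^bsub>ZS\<^esub> y) = augmentation x * augmentation y"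
  using weight_mult[of x y "carrier S" "\<lambda>_. 1"] assms
  by (simp add: augmentation_weight monoid_ring_simps)

lemma left_module_trivial_module: "left_module ZS trivial_module"
proof -
  have "abelian_group (trivial_module :: ('s \<Rightarrow>\<^sub>0 int, int) module)"
  proof (rule abelian_groupI)
    fix x :: int
    show "\<exists>y\<in>carrier (trivial_module :: ('s \<Rightarrow>\<^sub>0 int, int) module).
        y \<oplus>\<^bsub>trivial_module :: ('s \<Rightarrow>\<^sub>0 int, int) module\<^esub> x =
        \<zero>\<^bsub>trivial_module :: ('s \<Rightarrow>\<^sub>0 int, int) module\<^esub>"
      by (intro bexI[of _ "- x"]) (auto simp: trivial_module_def)
  qed (auto simp: trivial_module_def)
  then show ?thesis
    by (intro left_module.intro left_module_axioms.intro ring_monoid_ring)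
       (auto simp: trivial_module_def augmentation_mult,
        auto simp: augmentation_weight weight_add monoid_ring_simps algebra_simps)
qed

section \<open>Connected right Cayley graphs\<close>

text \<open>
  Sets that are unions of components stand in for paths: the sets \<open>X\<close> in the definition are the unions of
  components, for the graph without orientation, that contain the identity. Membership in such a set is what
  the functionals \<open>weight\<close> and the coordinates below test.
\<close>

definition cayley_connected :: "'s set \<Rightarrow> bool" where
  "cayley_connected A \<longleftrightarrow> A \<subseteq> carrier S \<and>
     (\<forall>X\<subseteq>carrier S. \<one>\<^bsub>S\<^esub> \<in> X \<and> (\<forall>s\<in>carrier S. \<forall>a\<in>A. s \<in> X \<longleftrightarrow> s \<otimes>\<^bsub>S\<^esub> a \<in> X) \<longrightarrow> X = carrier S)"

lemma cayley_connectedD: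
  assumes "cayley_connected A" "X \<subseteq> carrier S" "\<one>\<^bsub>S\<^esub> \<in> X"
    and "\<And>s a. s \<in> carrier S \<Longrightarrow> a \<in> A \<Longrightarrow> s \<in> X \<longleftrightarrow> s \<otimes>\<^bsub>S\<^esub> a \<in> X"
  shows "X = carrier S"
  using assms by (simp add: cayley_connected_def)

text \<open>
  Freeness of \<open>A0\<close> provides a homomorphism \<open>\<psi>\<close> from \<open>A0\<close> to the monoid ring that lifts \<open>d0\<close> through the
  augmentation. For \<open>z\<close> with \<open>d0 z = 1\<close> and \<open>r\<close> of augmentation \<open>0\<close>, the element \<open>r z\<close> lies in the image of
  \<open>d1\<close>, and \<open>r = r (1 - \<psi> z) + \<psi> (r z)\<close>. So \<open>1 - \<psi> z\<close> and the images of a basis of \<open>A1\<close> generate the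
  augmentation ideal, and the union of their supports is the required set \<open>A\<close>: the weight given by a union \<open>X\<close> of
  components vanishes on the left ideal that they generate, hence on every \<open>t - 1\<close>.
\<close>

lemma left_FP1_imp_cayley_connected:
  assumes "monoid_left_FP1 S"
  shows "\<exists>A. finite A \<and> cayley_connected A"
proof -
  interpret R: ring ZS by (rule ring_monoid_ring)
  let ?T = "trivial_module :: ('s \<Rightarrow>\<^sub>0 int, int) module"
  let ?reg = "regular_module ZS"
  obtain A0 A1 :: "('s \<Rightarrow>\<^sub>0 int, nat \<Rightarrow> 's \<Rightarrow>\<^sub>0 int) module" and d1 d0 where
    free: "fg_free ZS A0" "fg_free ZS A1"
    and d1: "d1 \<in> left_module_hom ZS A1 A0"
    and d0: "d0 \<in> left_module_hom ZS A0 ?T"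
    and exact: "d1 ` carrier A1 = {x \<in> carrier A0. d0 x = 0}"
    and onto: "d0 ` carrier A0 = UNIV"
    using assms unfolding monoid_left_FP1_def by blast
  interpret A0: left_module ZS A0 using free by (simp add: fg_free_def)
  interpret A1: left_module ZS A1 using free by (simp add: fg_free_def)
  interpret reg: left_module ZS ?reg by (rule left_module_regular_module) (rule ring_monoid_ring)
  interpret T: left_module ZS ?T by (rule left_module_trivial_module)
  have reg_simps: "carrier ?reg = carrier ZS" "x \<oplus>\<^bsub>?reg\<^esub> y = x + y" "\<zero>\<^bsub>?reg\<^esub> = 0"
    "a \<odot>\<^bsub>?reg\<^esub> x = a \<otimes>\<^bsub>ZS\<^esub> x" for a x y
    by (simp_all add: regular_module_def monoid_ring_simps)
  have T_simps: "carrier ?T = UNIV" "a \<odot>\<^bsub>?T\<^esub> n = augmentation a * n" "n \<oplus>\<^bsub>?T\<^esub> m = n + m" for a n m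
    by (simp_all add: trivial_module_def)
  obtain B0 where B0: "finite B0" "B0 \<subseteq> carrier A0"
    "\<forall>x\<in>carrier A0. \<exists>!c. c \<in> B0 \<rightarrow>\<^sub>E carrier ZS \<and> x = (\<Oplus>\<^bsub>A0\<^esub>b\<in>B0. c b \<odot>\<^bsub>A0\<^esub> b)"
    using free(1) unfolding fg_free_def by blast
  obtain B1 where B1: "finite B1" "B1 \<subseteq> carrier A1"
    "\<forall>x\<in>carrier A1. \<exists>!c. c \<in> B1 \<rightarrow>\<^sub>E carrier ZS \<and> x = (\<Oplus>\<^bsub>A1\<^esub>b\<in>B1. c b \<odot>\<^bsub>A1\<^esub> b)"
    using free(2) unfolding fg_free_def by blast
  \<comment> \<open>Multiples of the identity with the augmentations that a lift of \<open>d0\<close> must take on the basis.\<close>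
  define v where "v b = frag_cmul (d0 b) (frag_of \<one>\<^bsub>S\<^esub>)" for b
  have v: "v b \<in> carrier ?reg" "augmentation (v b) = d0 b" for b
    by (auto simp: v_def reg_simps monoid_ring_simps augmentation_weight weight_cmul)
  obtain \<psi> where \<psi>: "\<psi> \<in> left_module_hom ZS A0 ?reg"
    and \<psi>_lin: "\<And>c. c \<in> B0 \<rightarrow>\<^sub>E carrier ZS \<Longrightarrow>
      \<psi> (\<Oplus>\<^bsub>A0\<^esub>b\<in>B0. c b \<odot>\<^bsub>A0\<^esub> b) = (\<Oplus>\<^bsub>?reg\<^esub>b\<in>B0. c b \<odot>\<^bsub>?reg\<^esub> v b)"
    using fg_free_extend[OF A0.left_module_axioms reg.left_module_axioms B0, of v] v by blast
  have aug_hom: "augmentation \<in> left_module_hom ZS ?reg ?T"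
    by (auto simp: left_module_hom_def reg_simps T_simps augmentation_mult)
       (simp add: augmentation_weight weight_add)
  have aug_\<psi>: "augmentation (\<psi> x) = d0 x" if x: "x \<in> carrier A0" for x
  proof -
    obtain c where c: "c \<in> B0 \<rightarrow>\<^sub>E carrier ZS" "x = (\<Oplus>\<^bsub>A0\<^esub>b\<in>B0. c b \<odot>\<^bsub>A0\<^esub> b)"
      using B0(3) x by blast
    then have cc: "c \<in> B0 \<rightarrow> carrier ZS" by auto
    have "augmentation (\<psi> x) = (\<Oplus>\<^bsub>?T\<^esub>b\<in>B0. c b \<odot>\<^bsub>?T\<^esub> d0 b)"
      unfolding c(2) \<psi>_lin[OF c(1)]
      by (subst left_module_hom_finsum[OF reg.left_module_axioms T.left_module_axioms aug_hom B0(1) cc])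
         (simp_all add: v)
    also have "\<dots> = d0 x"
      unfolding c(2)
      by (subst left_module_hom_finsum[OF A0.left_module_axioms T.left_module_axioms d0 B0(1) cc])
         (use B0 in auto)
    finally show ?thesis .
  qed
  have \<psi>_closed: "\<psi> x \<in> carrier ZS" if "x \<in> carrier A0" for x
    using \<psi> that by (auto simp: left_module_hom_def reg_simps)
  have d1_closed: "d1 x \<in> carrier A0" "d0 (d1 x) = 0" if "x \<in> carrier A1" for x
    using exact that by blast+
  obtain z where z: "z \<in> carrier A0" "d0 z = 1"
    using onto by (metis UNIV_I imageE)
  \<comment> \<open>Generators of the augmentation ideal as a left ideal.\<close>
  define gens where "gens = insert (\<one>\<^bsub>ZS\<^esub> - \<psi> z) ((\<lambda>b. \<psi> (d1 b)) ` B1)"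
  have gens: "g \<in> carrier ZS \<and> augmentation g = 0" if "g \<in> gens" for g
  proof -
    have "augmentation (\<one>\<^bsub>ZS\<^esub> - \<psi> z) = 0"
      using aug_\<psi>[OF z(1)] z(2) by (simp add: augmentation_weight weight_diff monoid_ring_simps)
    then show ?thesis
      using that B1 z by (auto simp: gens_def aug_\<psi> d1_closed \<psi>_closed monoid_ring_diff_closed subset_iff)
  qed
  let ?A = "\<Union>g\<in>gens. Poly_Mapping.keys g"
  have "finite ?A"
    using B1 by (auto simp: gens_def)
  moreover have "cayley_connected ?A"
    unfolding cayley_connected_def
  proof (intro conjI allI impI)
    show "?A \<subseteq> carrier S"
      using gens by (auto simp: monoid_ring_simps)
    fix X assume X: "X \<subseteq> carrier S"
      and "\<one>\<^bsub>S\<^esub> \<in> X \<and> (\<forall>s\<in>carrier S. \<forall>a\<in>?A. s \<in> X \<longleftrightarrow> s \<otimes>\<^bsub>S\<^esub> a \<in> X)"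
    then have one: "\<one>\<^bsub>S\<^esub> \<in> X"
      and edge: "\<And>s a. s \<in> carrier S \<Longrightarrow> a \<in> ?A \<Longrightarrow> s \<in> X \<longleftrightarrow> s \<otimes>\<^bsub>S\<^esub> a \<in> X"
      by blast+
    \<comment> \<open>It suffices that \<open>f\<close> takes the same value at \<open>t\<close> and at the identity.\<close>
    define f :: "'s \<Rightarrow> int" where "f s = of_bool (s \<in> X)" for s
    have vanish: "weight f (r \<otimes>\<^bsub>ZS\<^esub> g) = 0" if "r \<in> carrier ZS" "g \<in> gens" for r g
    proof -
      have "weight f (r \<otimes>\<^bsub>ZS\<^esub> g) = weight f r * augmentation g"
        using that edge by (intro weight_mult[where A = ?A]) (auto simp: f_def)
      then show ?thesis using gens that by simp
    qed
    show "X = carrier S"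
    proof
      show "carrier S \<subseteq> X"
      proof
        fix t assume t: "t \<in> carrier S"
        define r where "r = frag_of t - \<one>\<^bsub>ZS\<^esub>"
        have r: "r \<in> carrier ZS"
          unfolding r_def using t by (intro monoid_ring_diff_closed) (simp_all add: monoid_ring_simps)
        have "augmentation r = 0"
          by (simp add: r_def augmentation_weight weight_diff monoid_ring_simps)
        then have "d0 (r \<odot>\<^bsub>A0\<^esub> z) = 0"
          using d0 r z by (simp add: left_module_hom_def T_simps)
        then have "r \<odot>\<^bsub>A0\<^esub> z \<in> d1 ` carrier A1"
          unfolding exact using A0.smult_closed r z by simp
        then obtain y where y: "y \<in> carrier A1" "r \<odot>\<^bsub>A0\<^esub> z = d1 y" by blast
        obtain c where c: "c \<in> B1 \<rightarrow>\<^sub>E carrier ZS" "y = (\<Oplus>\<^bsub>A1\<^esub>b\<in>B1. c b \<odot>\<^bsub>A1\<^esub> b)"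
          using B1(3) y by blast
        then have cc: "c \<in> B1 \<rightarrow> carrier ZS" by auto
        have "\<psi> (d1 y) = \<psi> (\<Oplus>\<^bsub>A0\<^esub>b\<in>B1. c b \<odot>\<^bsub>A0\<^esub> d1 b)"
          unfolding c(2)
          by (subst left_module_hom_finsum[OF A1.left_module_axioms A0.left_module_axioms d1 B1(1) cc])
             (use B1 in auto)
        also have "\<dots> = (\<Oplus>\<^bsub>?reg\<^esub>b\<in>B1. c b \<odot>\<^bsub>?reg\<^esub> \<psi> (d1 b))"
          by (rule left_module_hom_finsum[OF A0.left_module_axioms reg.left_module_axioms \<psi> B1(1) cc])
             (use B1 d1_closed in auto)
        finally have lin: "\<psi> (d1 y) = (\<Oplus>\<^bsub>?reg\<^esub>b\<in>B1. c b \<odot>\<^bsub>?reg\<^esub> \<psi> (d1 b))" .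
        have "weight f (\<psi> (d1 y)) = 0"
          unfolding lin
        proof (rule finsum_induct)
          show "abelian_monoid ?reg" by (rule reg.M.abelian_monoid_axioms)
          fix b assume b: "b \<in> B1"
          then have cb: "c b \<in> carrier ZS" using cc by auto
          have g: "\<psi> (d1 b) \<in> gens" using b by (simp add: gens_def)
          then show "c b \<odot>\<^bsub>?reg\<^esub> \<psi> (d1 b) \<in> carrier ?reg \<and> weight f (c b \<odot>\<^bsub>?reg\<^esub> \<psi> (d1 b)) = 0"
            using vanish[OF cb g] gens[OF g] cb by (simp add: reg_simps)
        qed (simp_all add: B1 reg_simps weight_add)
        moreover have "\<psi> (d1 y) = r \<otimes>\<^bsub>ZS\<^esub> \<psi> z"
          using \<psi> r z by (simp add: y(2)[symmetric] left_module_hom_def reg_simps)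
        moreover have "weight f (r \<otimes>\<^bsub>ZS\<^esub> (\<one>\<^bsub>ZS\<^esub> - \<psi> z)) = 0"
          using vanish r by (simp add: gens_def)
        ultimately have "weight f r = 0"
          by (simp add: monoid_ring_mult_linear weight_diff monoid_ring_unit r)
        then have "f t = f \<one>\<^bsub>S\<^esub>"
          by (simp add: r_def weight_diff monoid_ring_simps)
        then show "t \<in> X"
          using one by (auto simp: f_def split: if_splits)
      qed
    qed (rule X)
  qed
  ultimately show ?thesis by blast
qed

text \<open>
  The presentation has rank one in degree \<open>0\<close>, mapped to the integers by the augmentation, and one generator in
  degree \<open>1\<close> for each \<open>a\<close> in \<open>A\<close>, mapped to \<open>a - 1\<close>. The elements \<open>s\<close> for which \<open>s - 1\<close> is a boundary form
  a union of components, because \<open>s a - s = s (a - 1)\<close> is a boundary; so all \<open>s - 1\<close> are boundaries, and they span the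
  kernel of the augmentation.
\<close>

lemma cayley_connected_imp_left_FP1:
  assumes fin: "finite A" and conn: "cayley_connected A"
  shows "monoid_left_FP1 S"
proof -
  interpret R: ring ZS by (rule ring_monoid_ring)
  let ?T = "trivial_module :: ('s \<Rightarrow>\<^sub>0 int, int) module"
  let ?n = "card A"
  let ?A0 = "free_module ZS (Suc 0)" and ?A1 = "free_module ZS ?n"
  have AS: "A \<subseteq> carrier S"
    using conn by (simp add: cayley_connected_def)
  obtain a where a: "bij_betw a {0..<?n} A"
    using ex_bij_betw_nat_finite[OF fin] by blast
  have aS: "a i \<in> carrier S" if "i < ?n" for i
    using bij_betwE[OF a] that AS by auto
  define boundary where "boundary x = (\<Sum>i<?n. x i \<otimes>\<^bsub>ZS\<^esub> (frag_of (a i) - \<one>\<^bsub>ZS\<^esub>))" for x :: "nat \<Rightarrow> 's \<Rightarrow>\<^sub>0 int"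
  have gen_closed: "frag_of (a i) - \<one>\<^bsub>ZS\<^esub> \<in> carrier ZS" if "i < ?n" for i
    using aS[OF that] by (intro monoid_ring_diff_closed) (simp_all add: monoid_ring_simps)
  have sum_closed: "(\<Sum>i\<in>I. f i) \<in> carrier ZS" if "\<And>i. i \<in> I \<Longrightarrow> f i \<in> carrier ZS"
    for I :: "nat set" and f
    using that
    by (induction I rule: infinite_finite_induct)
       (use R.zero_closed R.a_closed in \<open>auto simp: monoid_ring_simps(2,3)\<close>)
  have sum_mult: "r \<otimes>\<^bsub>ZS\<^esub> (\<Sum>i\<in>I. f i) = (\<Sum>i\<in>I. r \<otimes>\<^bsub>ZS\<^esub> f i)" for r and I :: "nat set" and f
    by (induction I rule: infinite_finite_induct) (simp_all add: monoid_ring_mult_linear)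
  have A1_simps: "x \<in> carrier ?A1 \<longleftrightarrow> (\<forall>i. x i \<in> carrier ZS) \<and> (\<forall>i\<ge>?n. x i = 0)"
    "x \<oplus>\<^bsub>?A1\<^esub> y = (\<lambda>i. x i + y i)" "r \<odot>\<^bsub>?A1\<^esub> x = (\<lambda>i. r \<otimes>\<^bsub>ZS\<^esub> x i)" for x y r
    by (simp_all add: free_module_def monoid_ring_simps)
  have A0_simps: "x \<in> carrier ?A0 \<longleftrightarrow> (\<forall>i. x i \<in> carrier ZS) \<and> (\<forall>i\<ge>1. x i = 0)"
    "x \<oplus>\<^bsub>?A0\<^esub> y = (\<lambda>i. x i + y i)" "r \<odot>\<^bsub>?A0\<^esub> x = (\<lambda>i. r \<otimes>\<^bsub>ZS\<^esub> x i)" for x y r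
    by (simp_all add: free_module_def monoid_ring_simps)
  have boundary_closed: "boundary x \<in> carrier ZS" if "x \<in> carrier ?A1" for x
    unfolding boundary_def using that gen_closed by (intro sum_closed) (auto simp: A1_simps)
  have boundary_add: "boundary (\<lambda>i. x i + y i) = boundary x + boundary y" for x y
    by (simp add: boundary_def monoid_ring_mult_linear(1) sum.distrib)
  have boundary_diff: "boundary (\<lambda>i. x i - y i) = boundary x - boundary y" for x y
    by (simp add: boundary_def monoid_ring_mult_linear sum_subtractf)
  have aug_bd: "augmentation (boundary x) = 0" if x: "x \<in> carrier ?A1" for x
  proof -
    have "augmentation (x i \<otimes>\<^bsub>ZS\<^esub> (frag_of (a i) - \<one>\<^bsub>ZS\<^esub>)) = 0" if "i < ?n" for i
    proof -
      have "augmentation (x i \<otimes>\<^bsub>ZS\<^esub> (frag_of (a i) - \<one>\<^bsub>ZS\<^esub>)) =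
          augmentation (x i) * augmentation (frag_of (a i) - \<one>\<^bsub>ZS\<^esub>)"
        using x that gen_closed by (intro augmentation_mult) (auto simp: A1_simps)
      also have "\<dots> = 0"
        by (simp add: augmentation_weight weight_diff monoid_ring_simps)
      finally show ?thesis .
    qed
    moreover have "augmentation (\<Sum>i\<in>I. f i) = (\<Sum>i\<in>I. augmentation (f i))"
      for I :: "nat set" and f :: "nat \<Rightarrow> 's \<Rightarrow>\<^sub>0 int"
      by (induction I rule: infinite_finite_induct) (simp_all add: augmentation_weight weight_add)
    ultimately show ?thesis
      by (simp add: boundary_def)
  qed
  define J where "J = boundary ` carrier ?A1"
  have J_diff: "x - y \<in> J" if "x \<in> J" "y \<in> J" for x y
  proof -
    obtain x' y' where xy: "x' \<in> carrier ?A1" "y' \<in> carrier ?A1" "x = boundary x'" "y = boundary y'"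
      using \<open>x \<in> J\<close> \<open>y \<in> J\<close> by (auto simp: J_def)
    then have "(\<lambda>i. x' i - y' i) \<in> carrier ?A1"
      by (auto simp: A1_simps monoid_ring_diff_closed)
    then show ?thesis
      using xy boundary_diff[of x' y'] by (auto simp: J_def intro!: image_eqI)
  qed
  have J_zero: "0 \<in> J"
  proof -
    have "(\<lambda>_. 0) \<in> carrier ?A1" "boundary (\<lambda>_. 0) = 0"
      by (auto simp: A1_simps monoid_ring_simps boundary_def monoid_ring_mult_linear)
    then show ?thesis unfolding J_def by (metis imageI)
  qed
  have J_add: "x + y \<in> J" if "x \<in> J" "y \<in> J" for x y
    using J_diff[OF that(1) J_diff[OF J_zero that(2)]] by simp
  have J_edge: "frag_of (s \<otimes>\<^bsub>S\<^esub> b) - frag_of s \<in> J" if s: "s \<in> carrier S" and b: "b \<in> A" for s b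
  proof -
    obtain k where k: "k < ?n" "b = a k"
      using bij_betw_imp_surj_on[OF a] b by fastforce
    let ?x = "\<lambda>i. if i = k then frag_of s else 0"
    have "?x \<in> carrier ?A1"
      using s k by (auto simp: A1_simps monoid_ring_simps)
    moreover have "boundary ?x = frag_of s \<otimes>\<^bsub>ZS\<^esub> (frag_of (a k) - \<one>\<^bsub>ZS\<^esub>)"
      unfolding boundary_def using k
      by (subst sum.remove[of _ k]) (auto simp: monoid_ring_mult_linear intro!: sum.neutral)
    moreover have "frag_of s \<otimes>\<^bsub>ZS\<^esub> (frag_of (a k) - \<one>\<^bsub>ZS\<^esub>) = frag_of (s \<otimes>\<^bsub>S\<^esub> b) - frag_of s"
      using s k by (simp add: monoid_ring_mult_linear monoid_ring_simps)
    ultimately show ?thesis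
      unfolding J_def by (metis imageI)
  qed
  have J_of: "frag_of s - frag_of \<one>\<^bsub>S\<^esub> \<in> J" if "s \<in> carrier S" for s
  proof -
    let ?X = "{s \<in> carrier S. frag_of s - frag_of \<one>\<^bsub>S\<^esub> \<in> J}"
    have "s \<in> ?X \<longleftrightarrow> s \<otimes>\<^bsub>S\<^esub> b \<in> ?X" if s: "s \<in> carrier S" and b: "b \<in> A" for s b
    proof -
      let ?x = "frag_of s - frag_of \<one>\<^bsub>S\<^esub>"
      let ?y = "frag_of (s \<otimes>\<^bsub>S\<^esub> b) - frag_of \<one>\<^bsub>S\<^esub>"
      have "?y - ?x \<in> J" using J_edge[OF s b] by simp
      then have "?x \<in> J \<longleftrightarrow> ?y \<in> J"
        using J_add[of ?x "?y - ?x"] J_diff[of ?y "?y - ?x"] by auto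
      then show ?thesis using s b AS by auto
    qed
    moreover have "\<one>\<^bsub>S\<^esub> \<in> ?X" by (simp add: J_zero)
    ultimately have "?X = carrier S"
      by (intro cayley_connectedD[OF conn]) auto
    then show ?thesis using that by blast
  qed
  have J_kernel: "y \<in> J" if y: "y \<in> carrier ZS" "augmentation y = 0" for y
  proof -
    \<comment> \<open>Subtracting the augmentation makes the claim additive in \<open>y\<close>, so it reduces to \<open>y = s\<close>.\<close>
    have "y - frag_cmul (augmentation y) (frag_of \<one>\<^bsub>S\<^esub>) \<in> J"
      using y(1)[unfolded monoid_ring_simps]
    proof (induction y rule: frag_induction)
      case zero
      then show ?case by (simp add: augmentation_weight J_zero)
    next
      case (one s)
      then show ?case using J_of by (simp add: augmentation_weight)
    next
      case (diff x y)
      then show ?case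
        using J_diff[OF diff]
        by (simp add: augmentation_weight weight_diff frag_cmul_diff_distrib algebra_simps)
    qed
    then show ?thesis using y(2) by simp
  qed
  define d1 where "d1 x = (\<lambda>j::nat. if j = 0 then boundary x else 0)" for x
  define d0 where "d0 x = augmentation (x 0)" for x :: "nat \<Rightarrow> 's \<Rightarrow>\<^sub>0 int"
  have nontrivial: "\<one>\<^bsub>ZS\<^esub> \<noteq> \<zero>\<^bsub>ZS\<^esub>"
    by (simp add: monoid_ring_simps)
  have zero_closed: "0 \<in> carrier ZS" by (simp add: monoid_ring_simps)
  have "d1 \<in> left_module_hom ZS ?A1 ?A0"
    unfolding left_module_hom_def
  proof (intro CollectI conjI ballI)
    show "d1 \<in> carrier ?A1 \<rightarrow> carrier ?A0"
      using boundary_closed zero_closed by (auto simp: A0_simps d1_def)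
  next
    fix x y
    show "d1 (x \<oplus>\<^bsub>?A1\<^esub> y) = d1 x \<oplus>\<^bsub>?A0\<^esub> d1 y"
      by (simp add: A1_simps A0_simps d1_def boundary_add fun_eq_iff)
  next
    fix r x assume "r \<in> carrier ZS" "x \<in> carrier ?A1"
    then have "r \<otimes>\<^bsub>ZS\<^esub> x i \<otimes>\<^bsub>ZS\<^esub> (frag_of (a i) - \<one>\<^bsub>ZS\<^esub>) =
        r \<otimes>\<^bsub>ZS\<^esub> (x i \<otimes>\<^bsub>ZS\<^esub> (frag_of (a i) - \<one>\<^bsub>ZS\<^esub>))" if "i < ?n" for i
      using that gen_closed by (intro monoid_ring_mult_assoc) (auto simp: A1_simps)
    then show "d1 (r \<odot>\<^bsub>?A1\<^esub> x) = r \<odot>\<^bsub>?A0\<^esub> d1 x"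
      by (auto simp: A1_simps A0_simps d1_def boundary_def monoid_ring_mult_linear sum_mult)
  qed
  moreover have "d0 \<in> left_module_hom ZS ?A0 ?T"
    by (auto simp: left_module_hom_def A0_simps d0_def trivial_module_def augmentation_mult)
       (simp add: augmentation_weight weight_add)
  moreover have "d1 ` carrier ?A1 = {x \<in> carrier ?A0. d0 x = 0}"
  proof (intro equalityI subsetI)
    fix x assume "x \<in> d1 ` carrier ?A1"
    then show "x \<in> {x \<in> carrier ?A0. d0 x = 0}"
      using boundary_closed zero_closed by (auto simp: d0_def d1_def aug_bd A0_simps)
  next
    fix x assume x: "x \<in> {x \<in> carrier ?A0. d0 x = 0}"
    then have "x 0 \<in> J"
      by (intro J_kernel) (auto simp: A0_simps d0_def)
    then obtain y where y: "y \<in> carrier ?A1" "x 0 = boundary y"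
      by (auto simp: J_def)
    then have "x = d1 y"
      using x by (auto simp: d1_def A0_simps fun_eq_iff)
    then show "x \<in> d1 ` carrier ?A1" using y by blast
  qed
  moreover have "d0 ` carrier ?A0 = UNIV"
  proof -
    have "n \<in> d0 ` carrier ?A0" for n
      by (rule image_eqI[of _ _ "\<lambda>i. if i = 0 then frag_cmul n (frag_of \<one>\<^bsub>S\<^esub>) else 0"])
         (auto simp: d0_def A0_simps monoid_ring_simps augmentation_weight weight_cmul)
    then show ?thesis by blast
  qed
  ultimately show ?thesis
    unfolding monoid_left_FP1_def
    using fg_free_free_module[OF ring_monoid_ring nontrivial, of "Suc 0"]
      fg_free_free_module[OF ring_monoid_ring nontrivial, of ?n] by blast
qed

end

theorem left_FP1_iff_cayley_connected:
  assumes "monoid S"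
  shows "monoid_left_FP1 S \<longleftrightarrow> (\<exists>A. finite A \<and> cayley_connected S A)"
  using left_FP1_imp_cayley_connected[OF assms] cayley_connected_imp_left_FP1[OF assms] by blast

text \<open>
  Connectedness of the right Cayley graph of \<open>U\<close> with an identity adjoined, expressed inside \<open>U\<close>: the identity
  is adjacent to the elements of \<open>A\<close>, so a union of components is required to contain \<open>A\<close>.
\<close>

definition right_connected :: "'a::semigroup_mult set \<Rightarrow> 'a set \<Rightarrow> bool" where
  "right_connected U A \<longleftrightarrow> A \<subseteq> U \<and>
     (\<forall>X\<subseteq>U. A \<subseteq> X \<and> (\<forall>s\<in>U. \<forall>a\<in>A. s \<in> X \<longleftrightarrow> s * a \<in> X) \<longrightarrow> X = U)"

lemma right_connectedD:
  assumes "right_connected U A" "X \<subseteq> U" "A \<subseteq> X"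
    and "\<And>s a. s \<in> U \<Longrightarrow> a \<in> A \<Longrightarrow> s \<in> X \<longleftrightarrow> s * a \<in> X"
  shows "X = U"
  using assms by (simp add: right_connected_def)

text \<open>
  When \<open>U\<close> has an identity, adjoining a further one does not matter: the identity of \<open>U\<close> is put into
  \<open>A\<close>, which joins the two.
\<close>

lemma left_FP1_iff_right_connected:
  fixes U :: "'a::semigroup_mult set"
  assumes "subsemigroup U"
  shows "left_FP1 U \<longleftrightarrow> (\<exists>A. finite A \<and> right_connected U A)"
proof (cases "\<exists>e. is_identity U e")
  case True
  then obtain i where i: "is_identity U i" by blast
  have "(THE e. is_identity U e) = i"
    using i by (intro the_equality) (auto simp: is_identity_def)
  then have FP1: "left_FP1 U \<longleftrightarrow> monoid_left_FP1 \<lparr>carrier = U, monoid.mult = (*), one = i\<rparr>"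
    (is "_ \<longleftrightarrow> monoid_left_FP1 ?M")
    using True by (simp add: left_FP1_def)
  have M: "monoid ?M"
    using assms i by (intro monoidI) (auto simp: is_identity_def subsemigroup_def mult.assoc)
  have iU: "i \<in> U" and unit: "\<And>x. x \<in> U \<Longrightarrow> i * x = x"
    using i by (auto simp: is_identity_def)
  have "right_connected U (insert i A)" if A: "cayley_connected ?M A" for A
    unfolding right_connected_def
  proof (intro conjI allI impI)
    show "insert i A \<subseteq> U"
      using A iU by (simp add: cayley_connected_def[OF M])
    fix X assume "X \<subseteq> U"
      and "insert i A \<subseteq> X \<and> (\<forall>s\<in>U. \<forall>a\<in>insert i A. s \<in> X \<longleftrightarrow> s * a \<in> X)"
    then have "i \<in> X" and closed: "\<And>s a. s \<in> U \<Longrightarrow> a \<in> A \<Longrightarrow> s \<in> X \<longleftrightarrow> s * a \<in> X"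
      by blast+
    show "X = U"
      using cayley_connectedD[OF M A, of X] \<open>X \<subseteq> U\<close> \<open>i \<in> X\<close> closed by (simp cong: conj_cong)
  qed
  moreover have "cayley_connected ?M A" if A: "right_connected U A" for A
    unfolding cayley_connected_def[OF M]
  proof (intro conjI allI impI)
    have AU: "A \<subseteq> U"
      using A by (simp add: right_connected_def)
    then show "A \<subseteq> carrier ?M" by simp
    fix X assume X: "X \<subseteq> carrier ?M" and closed: "\<one>\<^bsub>?M\<^esub> \<in> X \<and>
      (\<forall>s\<in>carrier ?M. \<forall>a\<in>A. s \<in> X \<longleftrightarrow> s \<otimes>\<^bsub>?M\<^esub> a \<in> X)"
    then have "i * a \<in> X" if "a \<in> A" for a
      using that iU by auto
    then have "A \<subseteq> X"
      using AU unit by (metis subsetD subsetI)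
    then show "X = carrier ?M"
      using right_connectedD[OF A, of X] X closed by simp
  qed
  ultimately show ?thesis
    unfolding FP1 left_FP1_iff_cayley_connected[OF M] by (metis finite_insert)
next
  case False
  let ?M = "adjoin_one U"
  have FP1: "left_FP1 U \<longleftrightarrow> monoid_left_FP1 ?M"
    using False by (simp add: left_FP1_def)
  have M: "monoid ?M"
    using assms by (intro monoidI) (auto simp: adjoin_one_def subsemigroup_def mult.assoc)
  have M_simps: "carrier ?M = insert None (Some ` U)" "\<one>\<^bsub>?M\<^esub> = None"
    "None \<otimes>\<^bsub>?M\<^esub> y = y" "x \<otimes>\<^bsub>?M\<^esub> None = x" "Some a \<otimes>\<^bsub>?M\<^esub> Some b = Some (a * b)" for x y a b
    by (simp_all add: adjoin_one_def split: option.split)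
  have "right_connected U {a. Some a \<in> A}" if A: "cayley_connected ?M A" for A
    unfolding right_connected_def
  proof (intro conjI allI impI)
    show "{a. Some a \<in> A} \<subseteq> U"
      using A by (auto simp: cayley_connected_def[OF M] M_simps)
    fix X assume X: "X \<subseteq> U" and closed: "{a. Some a \<in> A} \<subseteq> X \<and>
      (\<forall>s\<in>U. \<forall>a\<in>{a. Some a \<in> A}. s \<in> X \<longleftrightarrow> s * a \<in> X)"
    have "insert None (Some ` X) = carrier ?M"
    proof (rule cayley_connectedD[OF M A])
      fix s a assume "s \<in> carrier ?M" "a \<in> A"
      then show "s \<in> insert None (Some ` X) \<longleftrightarrow> s \<otimes>\<^bsub>?M\<^esub> a \<in> insert None (Some ` X)"
        using closed by (cases s; cases a) (auto simp: M_simps)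
    qed (use X in \<open>auto simp: M_simps\<close>)
    then show "X = U"
      by (auto simp: M_simps)
  qed
  moreover have "finite {a. Some a \<in> A}" if "finite A" for A :: "'a option set"
    using finite_vimageI[OF that, of Some] by (simp add: vimage_def)
  moreover have "cayley_connected ?M (Some ` A)" if A: "right_connected U A" for A
    unfolding cayley_connected_def[OF M]
  proof (intro conjI allI impI)
    have AU: "A \<subseteq> U"
      using A by (simp add: right_connected_def)
    then show "Some ` A \<subseteq> carrier ?M"
      by (auto simp: M_simps)
    fix X assume X: "X \<subseteq> carrier ?M" and closed: "\<one>\<^bsub>?M\<^esub> \<in> X \<and>
      (\<forall>s\<in>carrier ?M. \<forall>a\<in>Some ` A. s \<in> X \<longleftrightarrow> s \<otimes>\<^bsub>?M\<^esub> a \<in> X)"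
    have "{u. Some u \<in> X} = U"
    proof (rule right_connectedD[OF A])
      show "{u. Some u \<in> X} \<subseteq> U" "A \<subseteq> {u. Some u \<in> X}"
        using X closed by (auto simp: M_simps)
      show "s \<in> {u. Some u \<in> X} \<longleftrightarrow> s * a \<in> {u. Some u \<in> X}" if "s \<in> U" "a \<in> A" for s a
        using closed that by (auto simp: M_simps)
    qed
    then show "X = carrier ?M"
      using X closed by (auto simp: M_simps)
  qed
  ultimately show ?thesis
    unfolding FP1 left_FP1_iff_cayley_connected[OF M] by (metis finite_imageI)
qed

section \<open>Relative rank over a subgroup\<close>

text \<open>
  Generating as a semigroup and as a group differ only by the inverses of the finitely many elements of \<open>B\<close>, as \<open>K\<close>
  contains inverses.
\<close>

lemma relative_rank_finite_iff:
  fixes G :: "'a::semigroup_mult monoid"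
  assumes "group G" and mult_G: "monoid.mult G = (*)" and K: "subgroup K G"
  shows "relative_rank (carrier G) K < \<infinity> \<longleftrightarrow>
    (\<exists>B. finite B \<and> B \<subseteq> carrier G \<and> generate G (K \<union> B) = carrier G)"
proof -
  interpret group G by fact
  have K_sub: "K \<subseteq> carrier G"
    using K by (rule subgroup.subset)
  have rank_iff: "relative_rank (carrier G) K < \<infinity> \<longleftrightarrow>
      (\<exists>B. finite B \<and> B \<subseteq> carrier G \<and> semigroup_span (K \<union> B) = carrier G)"
  proof -
    have "ecard B < \<infinity> \<longleftrightarrow> finite B" for B :: "'a set"
      by (simp add: ecard_def)
    then show ?thesis
      unfolding relative_rank_def INF_less_iff by auto
  qed
  have span_sub_generate: "semigroup_span Y \<subseteq> generate G Y" for Y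
  proof
    fix y assume "y \<in> semigroup_span Y"
    then show "y \<in> generate G Y"
    proof induction
      case (incl x)
      then show ?case by (rule generate.incl)
    next
      case (mult x y)
      then show ?case using generate.eng[of x G Y y] by (simp add: mult_G)
    qed
  qed
  show ?thesis
  proof
    assume "relative_rank (carrier G) K < \<infinity>"
    then obtain B where B: "finite B" "B \<subseteq> carrier G" "semigroup_span (K \<union> B) = carrier G"
      using rank_iff by blast
    moreover have "generate G (K \<union> B) \<subseteq> carrier G"
      using B K_sub by (intro generate_incl) auto
    ultimately show "\<exists>B. finite B \<and> B \<subseteq> carrier G \<and> generate G (K \<union> B) = carrier G"
      using span_sub_generate[of "K \<union> B"] by blast
  next
    assume "\<exists>B. finite B \<and> B \<subseteq> carrier G \<and> generate G (K \<union> B) = carrier G"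
    then obtain B where B: "finite B" "B \<subseteq> carrier G" "generate G (K \<union> B) = carrier G"
      by blast
    let ?B = "B \<union> m_inv G ` B"
    have closed: "K \<union> ?B \<subseteq> carrier G"
      using B K_sub by auto
    have finite_B: "finite ?B"
      using B by simp
    have "semigroup_span (K \<union> ?B) \<subseteq> carrier G"
      using span_sub_generate[of "K \<union> ?B"] generate_incl[OF closed] by blast
    moreover have "y \<in> semigroup_span (K \<union> ?B)" if "y \<in> generate G (K \<union> B)" for y
      using that
    proof induction
      case one
      then show ?case
        using K subgroup.one_closed by (blast intro: semigroup_span.incl)
    next
      case (incl h)
      then show ?case by (blast intro: semigroup_span.incl)
    next
      case (inv h)
      then show ?case
        using subgroup.m_inv_closed[OF K] by (auto intro!: semigroup_span.incl)
    next
      case (eng h1 h2)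
      then show ?case by (simp add: mult_G semigroup_span.mult)
    qed
    ultimately have "semigroup_span (K \<union> ?B) = carrier G"
      using B by blast
    then show "relative_rank (carrier G) K < \<infinity>"
      unfolding rank_iff using finite_B closed by (intro exI[of _ ?B]) simp
  qed
qed

section \<open>Completely simple semigroups in coordinates\<close>

text \<open>
  If \<open>L\<close> is a minimal left ideal, then so is every \<open>L s\<close>, and the union of these is a two-sided ideal, hence \<open>U\<close>.
  So \<open>u\<close> lies in a minimal left ideal, which the left ideal \<open>U v u\<close> has to exhaust.
\<close>

lemma completely_simple_left_divides:
  assumes cs: "completely_simple U" and u: "u \<in> U" and v: "v \<in> U"
  shows "\<exists>w\<in>U. u = w * v * u"
proof -
  have mult_closed: "x * y \<in> U" if "x \<in> U" "y \<in> U" for x y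
    using cs that by (auto simp: completely_simple_def simple_semigroup_def subsemigroup_def)
  obtain L where L: "minimal_left_ideal U L"
    using cs by (auto simp: completely_simple_def)
  then have L_ideal: "L \<noteq> {}" "L \<subseteq> U" "\<And>a x. a \<in> U \<Longrightarrow> x \<in> L \<Longrightarrow> a * x \<in> L"
    by (auto simp: minimal_left_ideal_def left_ideal_def)
  let ?I = "{x * s | x s. x \<in> L \<and> s \<in> U}"
  have "left_ideal U ?I"
    using L_ideal u mult_closed unfolding left_ideal_def
    by (auto simp: mult.assoc[symmetric]) blast+
  moreover have "right_ideal U ?I"
    using L_ideal u mult_closed unfolding right_ideal_def
    by (auto simp: mult.assoc) blast+
  ultimately have "?I = U"
    using cs by (auto simp: completely_simple_def simple_semigroup_def)
  then obtain x s where xs: "u = x * s" "x \<in> L" "s \<in> U"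
    using u by blast
  \<comment> \<open>The preimage in \<open>L\<close> of the left ideal \<open>U v u\<close> of \<open>L s\<close>.\<close>
  let ?J = "{y \<in> L. \<exists>w\<in>U. y * s = w * v * u}"
  \<comment> \<open>The element \<open>v v x\<close> shows that the preimage is nonempty: its image is \<open>v v u\<close>.\<close>
  have "v * (v * x) \<in> ?J"
    using xs v L_ideal by (auto simp: mult.assoc)
  moreover have "a * y \<in> ?J" if "a \<in> U" "y \<in> ?J" for a y
    using that L_ideal mult_closed by (auto simp: mult.assoc) (metis mult.assoc mult_closed)
  ultimately have "left_ideal U ?J"
    using L_ideal unfolding left_ideal_def by blast
  then have "?J = L"
    using L by (auto simp: minimal_left_ideal_def)
  then show ?thesis
    using xs by blast
qed

locale pointed_completely_simple =
  fixes U :: "'a::semigroup_mult set" and e :: 'a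
  assumes cs: "completely_simple U" and e_idem: "e \<in> idempotents U"
begin

abbreviation "G \<equiv> local_monoid U e"

lemma mult_closed [simp, intro]: "x \<in> U \<Longrightarrow> y \<in> U \<Longrightarrow> x * y \<in> U"
  using cs by (auto simp: completely_simple_def simple_semigroup_def subsemigroup_def)

lemma e_closed [simp, intro]: "e \<in> U" and ee: "e * e = e"
  using e_idem by (auto simp: idempotents_def)

lemma ee_left [simp]: "e * (e * x) = e * x"
  by (metis ee mult.assoc)

lemma carrier_G: "carrier G = {h \<in> U. e * h = h \<and> h * e = h}"
proof -
  have "h \<in> U \<and> e * h = h \<and> h * e = h \<longleftrightarrow> (\<exists>u\<in>U. h = e * u * e)" for h
  proof
    assume "h \<in> U \<and> e * h = h \<and> h * e = h"
    then show "\<exists>u\<in>U. h = e * u * e"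
      by (intro bexI[of _ h]) simp_all
  next
    assume "\<exists>u\<in>U. h = e * u * e"
    then show "h \<in> U \<and> e * h = h \<and> h * e = h"
      by (auto simp: mult.assoc ee)
  qed
  then show ?thesis
    by (simp add: local_monoid_def set_eq_iff) blast
qed

lemma mult_G [simp]: "monoid.mult G = (*)" and one_G [simp]: "\<one>\<^bsub>G\<^esub> = e"
  by (simp_all add: local_monoid_def)

text \<open>
  The coordinate of \<open>u\<close> in the maximal subgroup \<open>e U e\<close>.
\<close>

definition core :: "'a \<Rightarrow> 'a" where
  "core u = e * u * e"

lemma core_closed [simp, intro]: "u \<in> U \<Longrightarrow> core u \<in> carrier G"
  by (auto simp: core_def local_monoid_def)

lemma group_G: "group G"
proof (rule groupI)
  fix h assume h: "h \<in> carrier G"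
  then obtain w where w: "w \<in> U" "e = w * h * e"
    using completely_simple_left_divides[OF cs e_closed, of h] by (auto simp: carrier_G)
  then have "e * w * e * h = e"
    using h by (simp add: carrier_G mult.assoc ee)
  then show "\<exists>y\<in>carrier G. y \<otimes>\<^bsub>G\<^esub> h = \<one>\<^bsub>G\<^esub>"
    using w(1) core_closed[of w] by (auto simp: core_def)
qed (auto simp: carrier_G ee mult.assoc, simp add: mult.assoc[symmetric])

sublocale G: group G
  by (rule group_G)

lemma units_of_G: "units_of G = G"
  unfolding units_of_def G.Units_eq by (simp add: local_monoid_def)

definition coinv :: "'a \<Rightarrow> 'a" where
  "coinv u = inv\<^bsub>G\<^esub> core u"

lemma coinv_G [simp, intro]: "u \<in> U \<Longrightarrow> coinv u \<in> carrier G"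
  by (simp add: coinv_def)

lemma coinv_closed [simp, intro]: "u \<in> U \<Longrightarrow> coinv u \<in> U"
  using coinv_G carrier_G by blast

lemma coinv_e: "u \<in> U \<Longrightarrow> e * coinv u = coinv u" "u \<in> U \<Longrightarrow> coinv u * e = coinv u"
  using coinv_G carrier_G by blast+

lemma coinv_left: "u \<in> U \<Longrightarrow> coinv u * u * e = e"
  using G.l_inv[OF core_closed, of u] coinv_e(2)[of u]
  by (simp add: coinv_def core_def mult.assoc[symmetric])

lemma coinv_right: "u \<in> U \<Longrightarrow> e * u * coinv u = e"
  using G.r_inv[OF core_closed, of u] coinv_e(1)[of u]
  by (simp add: coinv_def core_def mult.assoc)

definition row_idem :: "'a \<Rightarrow> 'a" where
  "row_idem u = u * coinv u"

definition col_idem :: "'a \<Rightarrow> 'a" where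
  "col_idem u = coinv u * u"

text \<open>
  The idempotents of the minimal left ideal \<open>U e\<close>, exactly one in each minimal right ideal; dually, \<open>col_idems\<close>
  below consists of the idempotents of \<open>e U\<close>. In both cases idempotency follows from the two equations.
\<close>

definition row_idems :: "'a set" where
  "row_idems = {q \<in> U. q * e = q \<and> e * q = e}"

definition col_idems :: "'a set" where
  "col_idems = {l \<in> U. e * l = l \<and> l * e = e}"

lemma e_row_idem [simp, intro]: "e \<in> row_idems"
  by (simp add: row_idems_def ee)

lemma row_idem_in [simp, intro]: "u \<in> U \<Longrightarrow> row_idem u \<in> row_idems"
  by (simp add: row_idem_def row_idems_def mult.assoc coinv_e)
     (simp add: mult.assoc[symmetric] coinv_right)

lemma col_idem_in [simp, intro]: "u \<in> U \<Longrightarrow> col_idem u \<in> col_idems"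
  by (simp add: col_idem_def col_idems_def mult.assoc[symmetric] coinv_e coinv_left)

lemma row_idems_idempotent: "q \<in> row_idems \<Longrightarrow> q \<in> idempotents U"
  by (simp add: row_idems_def idempotents_def) (metis mult.assoc)

lemma col_idems_idempotent: "l \<in> col_idems \<Longrightarrow> l \<in> idempotents U"
  by (simp add: col_idems_def idempotents_def) (metis mult.assoc)

text \<open>
  Writing \<open>u = w e u\<close> moves a factor \<open>e\<close> next to \<open>u\<close>, where \<open>coinv u\<close> cancels \<open>e u\<close>.
\<close>

lemma von_Neumann:
  assumes "u \<in> U"
  shows "u * coinv u * u = u"
proof -
  obtain w where w: "u = w * e * u"
    using completely_simple_left_divides[OF cs assms e_closed] by blast
  then have "u * coinv u * u = w * (e * u * coinv u) * u"
    by (metis mult.assoc)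
  also have "\<dots> = u"
    using w by (simp add: coinv_right assms)
  finally show ?thesis .
qed

lemma row_idem_mult: "u \<in> U \<Longrightarrow> row_idem u * u = u"
  by (simp add: row_idem_def von_Neumann)

lemma row_idem_unique:
  assumes "q \<in> row_idems" "u \<in> U" "q = u * v"
  shows "row_idem u = q"
proof -
  have "row_idem u * q = q"
    using assms by (simp add: mult.assoc[symmetric] row_idem_mult)
  moreover have "row_idem u * q = row_idem u"
    using assms row_idem_in[of u] by (auto simp: row_idems_def) (metis mult.assoc)
  ultimately show ?thesis by simp
qed

lemma row_idem_idem: "q \<in> row_idems \<Longrightarrow> row_idem q = q"
  by (rule row_idem_unique[where v = e]) (auto simp: row_idems_def)

text \<open>
  The explicit witness makes the dual of \<open>completely_simple_left_divides\<close> follow from that lemma.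
\<close>

lemma right_divides:
  assumes u: "u \<in> U" and v: "v \<in> U"
  shows "\<exists>w\<in>U. u = u * v * w"
proof
  obtain w where w: "u = w * e * u"
    using completely_simple_left_divides[OF cs u e_closed] by blast
  have "u * v * (coinv (u * v) * u) = w * (e * (u * v) * coinv (u * v)) * u"
    by (subst (1) w) (simp add: mult.assoc)
  also have "\<dots> = u"
    using w u v by (simp add: coinv_right)
  finally show "u = u * v * (coinv (u * v) * u)" by simp
qed (use u v in auto)

lemma row_idem_mult_right:
  assumes "u \<in> U" "v \<in> U"
  shows "row_idem (u * v) = row_idem u"
proof -
  obtain w where "w \<in> U" "u = u * v * w"
    using right_divides assms by blast
  then have "row_idem u = u * v * (w * coinv u)"
    by (metis row_idem_def mult.assoc)
  then show ?thesis
    using row_idem_unique[of "row_idem u" "u * v"] assms by blast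
qed

text \<open>
  The right ideals \<open>q U\<close> for \<open>q \<in> row_idems\<close> are distinct, and a right ideal is determined by the \<open>row_idems\<close> in it,
  since \<open>u\<close> and \<open>row_idem u\<close> generate the same right ideal.
\<close>

lemma finite_right_ideals_iff: "finite {R. right_ideal U R} \<longleftrightarrow> finite row_idems"
proof
  let ?P = "\<lambda>q. {q * u | u. u \<in> U}"
  assume "finite {R. right_ideal U R}"
  moreover have "right_ideal U (?P q)" if "q \<in> row_idems" for q
    using that e_closed unfolding right_ideal_def row_idems_def
    by (auto simp: mult.assoc)
  then have "?P ` row_idems \<subseteq> {R. right_ideal U R}"
    by blast
  ultimately have "finite (?P ` row_idems)"
    by (rule rev_finite_subset)
  moreover have "inj_on ?P row_idems"
  proof
    fix q q' assume qq: "q \<in> row_idems" "q' \<in> row_idems" "?P q = ?P q'"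
    have "q' \<in> ?P q'"
      using qq(2) e_closed by (auto simp: row_idems_def intro!: exI[of _ e])
    then obtain u where "q' = q * u"
      using qq(3) by blast
    then show "q = q'"
      using row_idem_unique[OF qq(2), of q u] row_idem_idem[OF qq(1)] qq(1)
      by (simp add: row_idems_def)
  qed
  ultimately show "finite row_idems"
    by (rule finite_imageD)
next
  assume fin: "finite row_idems"
  have sub: "R \<subseteq> R'" if R: "right_ideal U R" "right_ideal U R'" "R \<inter> row_idems = R' \<inter> row_idems"
    for R R'
  proof
    fix u assume u: "u \<in> R"
    then have uU: "u \<in> U"
      using R by (auto simp: right_ideal_def)
    then have "row_idem u \<in> R"
      using R(1) u by (simp add: right_ideal_def row_idem_def)
    then have "row_idem u \<in> R'"
      using R(3) row_idem_in[OF uU] by blast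
    then have "row_idem u * u \<in> R'"
      using R(2) uU by (simp add: right_ideal_def)
    then show "u \<in> R'"
      using uU by (simp add: row_idem_mult)
  qed
  have "inj_on (\<lambda>R. R \<inter> row_idems) {R. right_ideal U R}"
    by (rule inj_onI) (use sub in blast)
  then show "finite {R. right_ideal U R}"
    by (rule inj_on_finite[where B = "Pow row_idems"]) (use fin in auto)
qed

text \<open>
  The entries of the normalised sandwich matrix.
\<close>

abbreviation sandwich :: "'a set" where
  "sandwich \<equiv> {l * q | l q. l \<in> col_idems \<and> q \<in> row_idems}"

lemma sandwich_G: "sandwich \<subseteq> carrier G"
  by (auto simp: carrier_G col_idems_def row_idems_def mult.assoc) (simp add: mult.assoc[symmetric])

lemma sandwich_span: "sandwich \<subseteq> semigroup_span (idempotents U)"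
  using row_idems_idempotent col_idems_idempotent
  by (blast intro: semigroup_span.intros)

lemma core_factorisation:
  assumes "u \<in> U"
  shows "row_idem u * core u = u * e" "core u * col_idem u = e * u"
proof -
  have "row_idem u * core u = u * (coinv u * e) * u * e"
    by (simp add: core_def mult.assoc row_idem_def)
  then show "row_idem u * core u = u * e"
    using assms by (simp add: coinv_e von_Neumann)
  show "core u * col_idem u = e * u"
    using assms von_Neumann[OF assms] by (simp add: core_def mult.assoc col_idem_def coinv_e)
       (metis coinv_e(1) mult.assoc)
qed

text \<open>
  The multiplication rule of a Rees matrix semigroup, read off in the group coordinate.
\<close>

lemma core_mult:
  assumes "u \<in> U" "v \<in> U"
  shows "core (u * v) = core u * (col_idem u * row_idem v) * core v"
proof -
  have "core (u * v) = (e * u) * (v * e)"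
    by (simp add: core_def mult.assoc)
  also have "\<dots> = (core u * col_idem u) * (row_idem v * core v)"
    using assms by (simp add: core_factorisation)
  finally show ?thesis by (simp add: mult.assoc)
qed

text \<open>
  An idempotent \<open>u\<close> satisfies \<open>core u = core u * p * core u\<close> for the sandwich entry \<open>p\<close> of its row and column, so its
  coordinate is the inverse of \<open>p\<close>; products of idempotents follow by \<open>core_mult\<close>.
\<close>

lemma core_span_idempotents:
  assumes "w \<in> semigroup_span (idempotents U)"
  shows "w \<in> U \<and> core w \<in> generate G sandwich"
  using assms
proof induction
  case (incl u)
  then have u: "u \<in> U" "u * u = u"
    by (auto simp: idempotents_def)
  let ?p = "col_idem u * row_idem u"
  have p: "?p \<in> sandwich" using u by blast
  then have pG: "?p \<in> carrier G" using sandwich_G by blast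
  have "core u \<otimes>\<^bsub>G\<^esub> ?p \<otimes>\<^bsub>G\<^esub> core u = core u"
    using core_mult[OF u(1) u(1)] u by simp
  then have "?p \<otimes>\<^bsub>G\<^esub> core u = \<one>\<^bsub>G\<^esub>"
    using pG u by (metis G.m_assoc G.m_closed G.r_cancel_one' core_closed G.l_cancel_one' G.l_cancel_one)
  then have "core u = inv\<^bsub>G\<^esub> ?p"
    using pG u by (metis G.inv_equality G.inv_inv core_closed)
  then show ?case
    using p u generate.inv[of ?p sandwich G] by simp
next
  case (mult x y)
  have "col_idem x * row_idem y \<in> generate G sandwich"
    using mult by (intro generate.incl) blast
  then show ?case
    using mult generate.eng[of _ G sandwich] by (simp add: core_mult)
qed

lemma generate_idempotent_core:
  "generate G (semigroup_span (idempotents U) \<inter> carrier G) = generate G sandwich"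
proof
  have "semigroup_span (idempotents U) \<inter> carrier G \<subseteq> generate G sandwich"
  proof
    fix w assume w: "w \<in> semigroup_span (idempotents U) \<inter> carrier G"
    then have "core w = w" by (simp add: core_def carrier_G)
    then show "w \<in> generate G sandwich" using core_span_idempotents[of w] w by auto
  qed
  then show "generate G (semigroup_span (idempotents U) \<inter> carrier G) \<subseteq> generate G sandwich"
    by (rule G.generate_subgroup_incl) (rule G.generate_is_subgroup[OF sandwich_G])
next
  show "generate G sandwich \<subseteq> generate G (semigroup_span (idempotents U) \<inter> carrier G)"
    by (rule G.mono_generate) (use sandwich_G sandwich_span in blast)
qed

section \<open>Connectedness of the Cayley graph in coordinates\<close>

text \<open>
  Right multiplication preserves the row, so a row can be entered from the adjoined identity only at an
  element of \<open>A\<close>.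
\<close>

lemma right_connected_finite_row_idems:
  assumes "finite A" "right_connected U A"
  shows "finite row_idems"
proof -
  let ?X = "{u \<in> U. row_idem u \<in> row_idem ` A}"
  have "?X = U"
    using assms(2)
    by (intro right_connectedD[OF assms(2)])
       (auto simp: row_idem_mult_right right_connected_def subset_iff)
  then have "row_idems \<subseteq> row_idem ` A"
    using row_idem_idem by (force simp: row_idems_def)
  then show ?thesis
    using assms(1) finite_surj by blast
qed

text \<open>
  By \<open>core_mult\<close>, an edge multiplies the group coordinate on the right by an element of the generated
  subgroup. Hence the elements with coordinate in this subgroup are a union of components.
\<close>

lemma right_connected_generate:
  assumes A: "right_connected U A"
  shows "generate G (sandwich \<union> core ` A) = carrier G"
proof
  let ?K = "generate G (sandwich \<union> core ` A)"
  have AU: "A \<subseteq> U" using A by (simp add: right_connected_def)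
  have sub: "sandwich \<union> core ` A \<subseteq> carrier G"
    using sandwich_G AU by auto
  show "?K \<subseteq> carrier G"
    by (rule G.generate_incl[OF sub])
  interpret K: subgroup ?K G
    by (rule G.generate_is_subgroup[OF sub])
  let ?X = "{u \<in> U. core u \<in> ?K}"
  have "s \<in> ?X \<longleftrightarrow> s * a \<in> ?X" if s: "s \<in> U" and a: "a \<in> A" for s a
  proof -
    let ?k = "col_idem s * row_idem a * core a"
    have "col_idem s * row_idem a \<in> ?K" "core a \<in> ?K"
      using s a AU by (auto intro!: generate.incl)
    then have k: "?k \<in> ?K"
      using K.m_closed by simp
    have eq: "core (s * a) = core s \<otimes>\<^bsub>G\<^esub> ?k"
      using s a AU by (auto simp: core_mult mult.assoc)
    have core_s: "core s = core (s * a) \<otimes>\<^bsub>G\<^esub> inv\<^bsub>G\<^esub> ?k"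
      unfolding eq using K.mem_carrier[OF k] s by (simp add: G.m_assoc del: mult_G one_G)
    have "core (s * a) \<in> ?K" if "core s \<in> ?K"
      unfolding eq by (rule K.m_closed[OF that k])
    moreover have "core s \<in> ?K" if "core (s * a) \<in> ?K"
      by (subst core_s) (rule K.m_closed[OF that K.m_inv_closed[OF k]])
    ultimately show ?thesis
      using s a AU by auto
  qed
  moreover have "A \<subseteq> ?X"
    using AU by (auto intro: generate.incl)
  ultimately have "?X = U"
    by (intro right_connectedD[OF A]) auto
  moreover have "core h = h" if "h \<in> carrier G" for h
    using that by (simp add: core_def carrier_G)
  ultimately show "carrier G \<subseteq> ?K"
    using carrier_G by force
qed

text \<open>
  In the row of \<open>f\<close>, the edges along \<open>q\<close> and along \<open>e\<close> from \<open>f g l\<close> lead to \<open>f g l q\<close> and to \<open>f g\<close>, so translation of the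
  group coordinate by \<open>l q\<close> stays in a component; edges along \<open>b\<close> give translation by \<open>b\<close>. The column is adjusted
  by the edge along \<open>e\<close>.
\<close>

lemma generate_right_connected:
  assumes BG: "B \<subseteq> carrier G" and gen: "generate G (sandwich \<union> B) = carrier G"
  shows "right_connected U {q * b | q b. q \<in> row_idems \<and> b \<in> insert e B}"
  unfolding right_connected_def
proof (intro conjI allI impI)
  let ?A = "{q * b | q b. q \<in> row_idems \<and> b \<in> insert e B}"
  have B: "b \<in> U" "e * b = b" "b * e = b" if "b \<in> B" for b
    using BG that by (auto simp: carrier_G)
  show "?A \<subseteq> U"
    using B by (auto simp: row_idems_def)
  fix X assume "X \<subseteq> U" and "?A \<subseteq> X \<and> (\<forall>s\<in>U. \<forall>a\<in>?A. s \<in> X \<longleftrightarrow> s * a \<in> X)"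
  then have AX: "?A \<subseteq> X" and edge: "\<And>s a. s \<in> U \<Longrightarrow> a \<in> ?A \<Longrightarrow> s \<in> X \<longleftrightarrow> s * a \<in> X"
    by auto
  have qA: "q \<in> ?A" if "q \<in> row_idems" for q
    using that by (force simp: row_idems_def)
  have bA: "b \<in> ?A" if "b \<in> B" for b
    using that B[OF that] by force
  have row: "f * h \<in> X" if f: "f \<in> row_idems" and h: "h \<in> carrier G" for f h
  proof -
    have fU: "f \<in> U" and fe: "f * e = f"
      using f by (auto simp: row_idems_def)
    have generator: "f * g \<in> X \<longleftrightarrow> f * (g * h) \<in> X"
      if h: "h \<in> sandwich \<union> B" and g: "g \<in> carrier G" for g h
      using h
    proof
      assume "h \<in> B"
      then show ?thesis
        using edge[of "f * g" h] bA fU g by (simp add: mult.assoc carrier_G)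
    next
      have gU: "g \<in> U" and ge: "g * e = g"
        using g by (auto simp: carrier_G)
      assume "h \<in> sandwich"
      then obtain l q where lq: "h = l * q" "l \<in> col_idems" "q \<in> row_idems" by blast
      then have lU: "l \<in> U" and le: "l * e = e" by (auto simp: col_idems_def)
      have "f * g * l \<in> X \<longleftrightarrow> f * g * l * q \<in> X"
        using lq qA fU gU lU by (intro edge) auto
      moreover have "f * g * l \<in> X \<longleftrightarrow> f * g * l * e \<in> X"
        using qA fU gU lU by (intro edge) auto
      moreover have "f * g * l * e = f * g"
        by (simp add: mult.assoc le ge)
      ultimately show ?thesis
        by (simp add: lq mult.assoc)
    qed
    have translate: "\<forall>g\<in>carrier G. f * g \<in> X \<longleftrightarrow> f * (g * h) \<in> X"
      if "h \<in> generate G (sandwich \<union> B)" for h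
      using that
    proof induction
      case one
      then show ?case by (simp add: carrier_G)
    next
      case (incl h)
      then show ?case using generator by blast
    next
      case (inv h)
      have hG: "h \<in> carrier G"
        using inv BG sandwich_G by blast
      show ?case
      proof
        fix g assume g: "g \<in> carrier G"
        define g' where "g' = g * inv\<^bsub>G\<^esub> h"
        have g': "g' \<in> carrier G"
          using G.m_closed[OF g G.inv_closed[OF hG]] by (simp add: g'_def)
        have "g' * h = g"
          using G.inv_solve_right'[OF g' g hG] by (simp add: g'_def)
        then show "f * g \<in> X \<longleftrightarrow> f * (g * inv\<^bsub>G\<^esub> h) \<in> X"
          using generator[OF inv g'] by (simp add: g'_def)
      qed
    next
      case (eng h1 h2)
      have "h1 \<in> carrier G"
        using eng gen by blast
      then have "f * (g * h1) \<in> X \<longleftrightarrow> f * (g * h1 * h2) \<in> X" if "g \<in> carrier G" for g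
        using eng.IH(2) G.m_closed[OF that] by simp
      then show ?case
        using eng.IH(1) by (simp add: mult.assoc)
    qed
    have "e \<in> carrier G" using G.one_closed by simp
    moreover have "f * e \<in> X" using AX qA f by (auto simp: fe)
    ultimately have "f * (e * h) \<in> X"
      using translate h gen by blast
    then show ?thesis using h by (simp add: carrier_G)
  qed
  show "X = U"
  proof
    show "X \<subseteq> U" by fact
    show "U \<subseteq> X"
    proof
      fix u assume u: "u \<in> U"
      then have "u * e \<in> X"
        using row[of "row_idem u" "core u"] by (simp add: core_factorisation)
      then show "u \<in> X"
        using edge[OF u qA[OF e_row_idem]] by simp
    qed
  qed
qed

end

theorem theorem7:
  fixes U :: "'a::semigroup_mult set" and H :: "'a monoid"
  assumes "completely_simple U"
    and "maximal_subgroup U H"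
  shows "left_FP1 U \<longleftrightarrow>
    finite {R. right_ideal U R} \<and>
    relative_rank (carrier H)
      (generate H (semigroup_span (idempotents U) \<inter> carrier H)) < \<infinity>"
proof -
  obtain e where e: "e \<in> idempotents U" and H: "H = units_of (local_monoid U e)"
    using assms(2) by (auto simp: maximal_subgroup_def)
  interpret pointed_completely_simple U e
    by unfold_locales (fact assms(1), fact e)
  let ?K = "generate G sandwich"
  have "subsemigroup U"
    using assms(1) by (simp add: completely_simple_def simple_semigroup_def)
  then have FP1: "left_FP1 U \<longleftrightarrow> (\<exists>A. finite A \<and> right_connected U A)"
    by (rule left_FP1_iff_right_connected)
  have K: "subgroup ?K G"
    by (rule G.generate_is_subgroup[OF sandwich_G])
  have rank: "relative_rank (carrier G) ?K < \<infinity> \<longleftrightarrow>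
      (\<exists>B. finite B \<and> B \<subseteq> carrier G \<and> generate G (?K \<union> B) = carrier G)"
    by (rule relative_rank_finite_iff[OF group_G mult_G K])
  have absorb: "generate G (?K \<union> B) = generate G (sandwich \<union> B)" if B: "B \<subseteq> carrier G" for B
  proof
    have "?K \<subseteq> generate G (sandwich \<union> B)" "B \<subseteq> generate G (sandwich \<union> B)"
      by (auto intro: G.mono_generate[THEN subsetD] generate.incl)
    then have "?K \<union> B \<subseteq> generate G (sandwich \<union> B)"
      by (rule Un_least)
    moreover have "sandwich \<union> B \<subseteq> carrier G"
      using sandwich_G B by (rule Un_least)
    ultimately show "generate G (?K \<union> B) \<subseteq> generate G (sandwich \<union> B)"
      by (intro G.generate_subgroup_incl G.generate_is_subgroup)
    show "generate G (sandwich \<union> B) \<subseteq> generate G (?K \<union> B)"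
      by (rule G.mono_generate) (use generate.incl[of _ sandwich G] in blast)
  qed
  have "left_FP1 U \<longleftrightarrow> finite row_idems \<and> relative_rank (carrier G) ?K < \<infinity>"
  proof
    assume "left_FP1 U"
    then obtain A where A: "finite A" "right_connected U A"
      using FP1 by blast
    have "core ` A \<subseteq> carrier G"
      using A(2) by (auto simp: right_connected_def)
    then have "relative_rank (carrier G) ?K < \<infinity>"
      unfolding rank using A absorb right_connected_generate[OF A(2)]
      by (intro exI[of _ "core ` A"]) simp
    then show "finite row_idems \<and> relative_rank (carrier G) ?K < \<infinity>"
      using right_connected_finite_row_idems[OF A] by simp
  next
    assume R: "finite row_idems \<and> relative_rank (carrier G) ?K < \<infinity>"
    then obtain B where B: "finite B" "B \<subseteq> carrier G" "generate G (?K \<union> B) = carrier G"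
      using rank by blast
    let ?A = "{q * b | q b. q \<in> row_idems \<and> b \<in> insert e B}"
    have "right_connected U ?A"
      using B absorb by (intro generate_right_connected) simp_all
    moreover have "finite ?A"
      using R B by (intro finite_image_set2) auto
    ultimately show "left_FP1 U"
      using FP1 by blast
  qed
  then show ?thesis
    by (simp only: H units_of_G finite_right_ideals_iff generate_idempotent_core)
qed

end
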